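(* For any $\mu\in\mathbb{C}$, there exists an admissible Poisson bracket $\langle\cdot,\cdot\rangle_\mu$ on the algebra $\mathcal{M}_*^{\leq\infty}=\mathbb{C}[E_2,E_4,E_6]$ of quasimodular forms defined by the following values on the generators: $$\langle E_4,E_6\rangle_\mu=-2\Delta,\quad \langle E_2,E_4\rangle_\mu=4E_6E_2+\mu E_4^2,\quad \langle E_2,E_6\rangle_\mu=6E_4^2E_2-2\mu E_4E_6.$$ Moreover: (i) this Poisson bracket is Jacobian with potential $k_\mu=-2\Delta E_2+\mu E_4^2E_6$; (ii) the Poisson algebras $(\mathcal{M}_*^{\leq\infty},\langle\cdot,\cdot\rangle_\mu)$ and $(\mathcal{M}_*^{\leq\infty},\langle\cdot,\cdot\rangle_{\mu'})$ are Poisson modular isomorphic for all $\mu$ and $\mu'$ in $\mathbb{C}^*$; (iii) for any $\mu\in\mathbb{C}$, the Poisson center of $(\mathcal{M}_*^{\leq\infty},\langle\cdot,\cdot\rangle_\mu)$ is the polynomial algebra $\mathbb{C}[k_\mu]$.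
   Context: Modular forms are for $\mathrm{SL}(2,\mathbb{Z})$. The Eisenstein series are $E_2=1-24\sum_{n\ge1}\sigma_1(n)q^n$, $E_4=1+240\sum_{n\ge1}\sigma_3(n)q^n$, $E_6=1-504\sum_{n\ge1}\sigma_5(n)q^n$, with $q=e^{2\pi i z}$; they are algebraically independent over $\mathbb{C}$. The algebra of modular forms is $\mathcal{M}_*=\mathbb{C}[E_4,E_6]$, and the algebra of quasimodular forms is $\mathcal{M}_*^{\leq\infty}=\mathbb{C}[E_2,E_4,E_6]$, graded by the weight ($E_j$ has weight $j$). $\mathcal{M}_k$ is the space of modular forms of weight $k$ (weight-$k$ part of $\mathcal{M}_*$), and $\mathcal{M}_k^{\leq s}=\bigoplus_{j=0}^s\mathcal{M}_{k-2j}E_2^j$ is the space of quasimodular forms of weight $k$ and depth (degree in $E_2$) at most $s$. $\Delta=E_4^3-E_6^2$. $D=\frac{1}{2\pi i}\frac{d}{dz}$, and $\mathrm{RC}_1$ is the first Rankin-Cohen bracket on $\mathcal{M}_*$, i.e. the bilinear extension of $\mathrm{RC}_1(f,g)=kfD(g)-\ell gD(f)$ for $f\in\mathcal{M}_k$, $g\in\mathcal{M}_\ell$ (so $\mathrm{RC}_1(E_4,E_6)=-2\Delta$). A Poisson bracket on a commutative $\mathbb{C}$-algebra is a bilinear skew-symmetric map satisfying the Leibniz rule in each argument and the Jacobi identity. A Poisson bracket $b$ on $\mathcal{M}_*^{\leq\infty}$ is admissible if (1) its restriction to $\mathcal{M}_*$ is $\mathrm{RC}_1$, and (2) $b(\mathcal{M}_k^{\leq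 s},\mathcal{M}_\ell^{\leq t})\subset\mathcal{M}_{k+\ell+2}^{\leq s+t}$ for all even $k,\ell$ and all integers $s,t\ge 0$. Identify $\mathcal{M}_*^{\leq\infty}$ with $\mathbb{C}[x,y,z]$ via $x=E_2$, $y=E_4$, $z=E_6$. A Poisson bracket $b$ on $\mathbb{C}[x,y,z]$ is Jacobian of potential $k\in\mathbb{C}[x,y,z]$ if $(b(y,z),b(z,x),b(x,y))=\mathrm{grad}\,k$; equivalently $b(f,g)=\mathrm{jac}(f,g,k)$, the Jacobian determinant, for all $f,g$. A Poisson isomorphism (algebra isomorphism intertwining the brackets) $\varphi:(\mathcal{M}_*^{\leq\infty},b_1)\to(\mathcal{M}_*^{\leq\infty},b_2)$ is modular if $\varphi(\mathcal{M}_* )\subset\mathcal{M}_*$; two Poisson structures are Poisson modular isomorphic if such a $\varphi$ exists. The Poisson center of a Poisson algebra $(A,b)$ is $\{g\in A: b(f,g)=0\ \text{for all } f\in A\}$. *)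

theory Defs
  imports "HOL-Analysis.Analysis" "HOL-Computational_Algebra.Computational_Algebra"
begin

definition divisor_sum :: "nat \<Rightarrow> nat \<Rightarrow> nat" where
  "divisor_sum k n = (\<Sum>d | d dvd n. d ^ k)"

definition nome :: "complex \<Rightarrow> complex" where
  "nome z = exp (2 * of_real pi * \<i> * z)"

text \<open>The series converge for \<open>Im z > 0\<close>; values elsewhere are irrelevant.\<close>

definition eis2 :: "complex \<Rightarrow> complex" where
  "eis2 z = 1 - 24 * (\<Sum>n. of_nat (divisor_sum 1 (Suc n)) * nome z ^ Suc n)"

definition eis4 :: "complex \<Rightarrow> complex" where
  "eis4 z = 1 + 240 * (\<Sum>n. of_nat (divisor_sum 3 (Suc n)) * nome z ^ Suc n)"

definition eis6 :: "complex \<Rightarrow> complex" where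
  "eis6 z = 1 - 504 * (\<Sum>n. of_nat (divisor_sum 5 (Suc n)) * nome z ^ Suc n)"

definition Dz :: "(complex \<Rightarrow> complex) \<Rightarrow> complex \<Rightarrow> complex" where
  "Dz F z = deriv F z / (2 * of_real pi * \<i>)"

text \<open>
  As the Eisenstein series are algebraically independent, quasimodular forms are identified with
  polynomials in \<open>x = E2\<close>, \<open>y = E4\<close>, \<open>z = E6\<close>.  They are represented in \<open>((\<complex>[z])[y])[x]\<close>, that is,
  \<open>coeff (coeff (coeff f i) j) l\<close> is the coefficient of \<open>x^i y^j z^l\<close>.  The function on the upper
  half-plane given by such a polynomial is recovered by \<open>qm_fun\<close>.
\<close>

type_synonym qm = "complex poly poly poly"

definition cst :: "complex \<Rightarrow> qm" where "cst c = [:[:[:c:]:]:]"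

definition E2 :: qm where "E2 = [:0, 1:]"
definition E4 :: qm where "E4 = [:[:0, 1:]:]"
definition E6 :: qm where "E6 = [:[:[:0, 1:]:]:]"

definition Delta :: qm where "Delta = E4 ^ 3 - E6 ^ 2"

definition qm_fun :: "qm \<Rightarrow> complex \<Rightarrow> complex" where
  "qm_fun f z = poly (poly (poly f [:[:eis2 z:]:]) [:eis4 z:]) (eis6 z)"

definition modular_forms :: "qm set" where
  "modular_forms = range (\<lambda>p. [:p:])"

text \<open>Weights are integers: there are no nonzero forms of negative weight.\<close>

definition modular_weight :: "int \<Rightarrow> qm set" where
  "modular_weight k = {f \<in> modular_forms.
     \<forall>j l. coeff (coeff (coeff f 0) j) l \<noteq> 0 \<longrightarrow> 4 * int j + 6 * int l = k}"

definition quasimodular :: "int \<Rightarrow> nat \<Rightarrow> qm set" where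
  "quasimodular k s =
     {(\<Sum>j\<le>s. F j * E2 ^ j) | F. \<forall>j\<le>s. F j \<in> modular_weight (k - 2 * int j)}"

definition poisson_bracket :: "(qm \<Rightarrow> qm \<Rightarrow> qm) \<Rightarrow> bool" where
  "poisson_bracket b \<longleftrightarrow>
     (\<forall>f g h. b (f + g) h = b f h + b g h) \<and>
     (\<forall>f g h. b f (g + h) = b f g + b f h) \<and>
     (\<forall>c f g. b (cst c * f) g = cst c * b f g) \<and>
     (\<forall>c f g. b f (cst c * g) = cst c * b f g) \<and>
     (\<forall>f g. b f g = - b g f) \<and>
     (\<forall>f g h. b (f * g) h = f * b g h + b f h * g) \<and>
     (\<forall>f g h. b f (g * h) = g * b f h + b f g * h) \<and>
     (\<forall>f g h. b f (b g h) + b g (b h f) + b h (b f g) = 0)"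

definition RC1 ::
    "int \<Rightarrow> int \<Rightarrow> (complex \<Rightarrow> complex) \<Rightarrow> (complex \<Rightarrow> complex) \<Rightarrow> complex \<Rightarrow> complex" where
  "RC1 k l F G z = of_int k * F z * Dz G z - of_int l * G z * Dz F z"

text \<open>
  In the first condition it suffices to speak about homogeneous modular forms, since both the bracket
  and the first Rankin-Cohen bracket are bilinear and modular forms are sums of homogeneous ones.
\<close>

definition admissible :: "(qm \<Rightarrow> qm \<Rightarrow> qm) \<Rightarrow> bool" where
  "admissible b \<longleftrightarrow>
     (\<forall>k l. \<forall>f \<in> modular_weight k. \<forall>g \<in> modular_weight l.
        b f g \<in> modular_forms \<and>
        (\<forall>z. Im z > 0 \<longrightarrow> qm_fun (b f g) z = RC1 k l (qm_fun f) (qm_fun g) z)) \<and>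
     (\<forall>k l s t. even k \<longrightarrow> even l \<longrightarrow>
        (\<forall>f \<in> quasimodular k s. \<forall>g \<in> quasimodular l t.
           b f g \<in> quasimodular (k + l + 2) (s + t)))"

definition grad :: "qm \<Rightarrow> qm \<times> qm \<times> qm" where
  "grad k = (pderiv k, map_poly pderiv k, map_poly (map_poly pderiv) k)"

definition jacobian_with_potential :: "(qm \<Rightarrow> qm \<Rightarrow> qm) \<Rightarrow> qm \<Rightarrow> bool" where
  "jacobian_with_potential b k \<longleftrightarrow> (b E4 E6, b E6 E2, b E2 E4) = grad k"

definition algebra_iso :: "(qm \<Rightarrow> qm) \<Rightarrow> bool" where
  "algebra_iso \<phi> \<longleftrightarrow> bij \<phi> \<and> \<phi> 1 = 1 \<and>
     (\<forall>f g. \<phi> (f + g) = \<phi> f + \<phi> g) \<and>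
     (\<forall>f g. \<phi> (f * g) = \<phi> f * \<phi> g) \<and>
     (\<forall>c f. \<phi> (cst c * f) = cst c * \<phi> f)"

definition poisson_modular_isomorphic ::
    "(qm \<Rightarrow> qm \<Rightarrow> qm) \<Rightarrow> (qm \<Rightarrow> qm \<Rightarrow> qm) \<Rightarrow> bool" where
  "poisson_modular_isomorphic b1 b2 \<longleftrightarrow>
     (\<exists>\<phi>. algebra_iso \<phi> \<and> (\<forall>f g. \<phi> (b1 f g) = b2 (\<phi> f) (\<phi> g)) \<and>
          \<phi> ` modular_forms \<subseteq> modular_forms)"

definition poisson_center :: "(qm \<Rightarrow> qm \<Rightarrow> qm) \<Rightarrow> qm set" where
  "poisson_center b = {g. \<forall>f. b f g = 0}"

definition poly_at :: "qm \<Rightarrow> complex poly \<Rightarrow> qm" where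
  "poly_at h p = poly (map_poly cst p) h"

definition bracket_values :: "complex \<Rightarrow> (qm \<Rightarrow> qm \<Rightarrow> qm) \<Rightarrow> bool" where
  "bracket_values \<mu> b \<longleftrightarrow>
     b E4 E6 = - 2 * Delta \<and>
     b E2 E4 = 4 * E6 * E2 + cst \<mu> * E4 ^ 2 \<and>
     b E2 E6 = 6 * E4 ^ 2 * E2 - 2 * cst \<mu> * E4 * E6"

definition potential :: "complex \<Rightarrow> qm" where
  "potential \<mu> = - 2 * Delta * E2 + cst \<mu> * E4 ^ 2 * E6"

end

theory Submission
  imports Defs
begin

text \<open>
  The bracket is the Jacobian determinant \<open>jac k_\<mu> f g\<close>, so Jacobi's identity and the potential are
  immediate; on modular forms it is \<open>-2 \<Delta> (f_y g_z - f_z g_y)\<close>. By Euler's identity and the chain rule,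
  that this is the Rankin-Cohen bracket reduces to \<open>4 E4 DE6 - 6 E6 DE4 = -2 \<Delta>\<close>. This follows from
  Ramanujan's \<open>3 DE4 = E2 E4 - E6\<close> and \<open>2 DE6 = E2 E6 - E4\<^sup>2\<close>, which are convolution identities for divisor
  sums; both are instances of one elementary identity of Liouville type for sums over \<open>a x + b y = n\<close>.
  The isomorphism for \<open>\<mu>, \<mu>' \<noteq> 0\<close> is \<open>x \<mapsto> (\<mu> / \<mu>') x\<close>. The potential has degree 1 in \<open>x\<close>, with leading
  coefficient \<open>-2 \<Delta>\<close>, and the center is found by induction on the degree in \<open>x\<close>.
\<close>

section \<open>Liouville's identity\<close>

text \<open>Only the \<open>q\<close>-series of the Eisenstein series are at hand. The usual proof
  of Ramanujan's equations uses modularity and the dimensions of spaces of modular forms; comparing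
  coefficients of \<open>q^n\<close> replaces both by arithmetic of divisor sums. The obstacle is
  \<open>E4^2\<close> in the equation for \<open>E6\<close>: its coefficients are a convolution of
  \<open>\<sigma>_3\<close> with itself, whose evaluation brings in \<open>\<sigma>_7\<close>,
  absent from the equation. The test functions \<open>b^6\<close> and \<open>a^3 b^3\<close> both
  contribute \<open>\<sigma>_7\<close>, with coefficients -9/7 and -69/140, so the weights 69 and
  -180 eliminate it. What remains, 504 times the convolution of \<open>\<sigma>_1\<close> and
  \<open>\<sigma>_5\<close> minus 2400 times that of \<open>\<sigma>_3\<close> with itself, is 1/24
  of the convolution part of \<open>E2 E6 - E4^2\<close>.\<close>

definition conv_set :: "nat \<Rightarrow> (nat \<times> nat \<times> nat \<times> nat) set" where
  "conv_set n = {(a, b, x, y). a > 0 \<and> b > 0 \<and> x > 0 \<and> y > 0 \<and> a * x + b * y = n}"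

lemma finite_conv_set [simp]: "finite (conv_set n)"
proof (rule finite_subset)
  show "conv_set n \<subseteq> {..n} \<times> {..n} \<times> {..n} \<times> {..n}"
  proof
    fix t assume "t \<in> conv_set n"
    then obtain a b x y where t: "t = (a, b, x, y)"
      and p: "a > 0" "b > 0" "x > 0" "y > 0" and e: "a * x + b * y = n"
      by (auto simp: conv_set_def)
    have "a \<le> a * x" "x \<le> a * x" "b \<le> b * y" "y \<le> b * y" using p by auto
    then have "a \<le> n" "x \<le> n" "b \<le> n" "y \<le> n" using e by linarith+
    then show "t \<in> {..n} \<times> {..n} \<times> {..n} \<times> {..n}"
      unfolding t by auto
  qed
qed auto

text \<open>\<open>a x + b y = (a + b) x + b (y - x)\<close>. Positivity of \<open>y - x\<close> is
  the condition on the left, positivity of the old \<open>a\<close> the condition on the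
  right.\<close>

lemma sum_conv_set_shift:
  fixes g :: "nat \<Rightarrow> nat \<Rightarrow> nat \<Rightarrow> nat \<Rightarrow> 'a::comm_monoid_add"
  shows "(\<Sum>(a, b, x, y) \<in> {(a, b, x, y) \<in> conv_set n. x < y}. g (a + b) b x (y - x)) =
         (\<Sum>(a, b, x, y) \<in> {(a, b, x, y) \<in> conv_set n. b < a}. g a b x y)"
proof (rule sum.reindex_bij_witness[where
        j = "\<lambda>(a, b, x, y). (a + b, b, x, y - x)" and i = "\<lambda>(a, b, x, y). (a - b, b, x, y + x)"])
  fix t assume "t \<in> {(a, b, x, y) \<in> conv_set n. x < y}"
  then obtain a b x y where t: "t = (a, b, x, y)" "x < y" and "(a, b, x, y) \<in> conv_set n"
    by auto
  \<comment> \<open>Writing \<open>y = x + k\<close> removes the truncated subtraction.\<close>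
  moreover obtain k where "y = x + k" "k > 0"
    using less_imp_add_positive[OF t(2)] by metis
  ultimately have "t = (a, b, x, x + k)" "k > 0" "(a, b, x, x + k) \<in> conv_set n"
    by auto
  then show "(\<lambda>(a, b, x, y). (a + b, b, x, y - x)) t \<in> {(a, b, x, y) \<in> conv_set n. b < a}"
    by (simp add: conv_set_def algebra_simps)
next
  fix t assume "t \<in> {(a, b, x, y) \<in> conv_set n. b < a}"
  then obtain a b x y where t: "t = (a, b, x, y)" "b < a" and "(a, b, x, y) \<in> conv_set n"
    by auto
  moreover obtain k where "a = b + k" "k > 0"
    using less_imp_add_positive[OF t(2)] by metis
  ultimately have "t = (b + k, b, x, y)" "k > 0" "(b + k, b, x, y) \<in> conv_set n"
    by auto
  then show "(\<lambda>(a, b, x, y). (a - b, b, x, y + x)) t \<in> {(a, b, x, y) \<in> conv_set n. x < y}"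
    by (simp add: conv_set_def algebra_simps)
qed auto

lemma sum_conv_set_swap:
  fixes g :: "nat \<Rightarrow> nat \<Rightarrow> nat \<Rightarrow> nat \<Rightarrow> 'a::comm_monoid_add"
  shows "(\<Sum>(a, b, x, y) \<in> {(a, b, x, y) \<in> conv_set n. P a b x y}. g a b x y) =
         (\<Sum>(a, b, x, y) \<in> {(a, b, x, y) \<in> conv_set n. P b a y x}. g b a y x)"
  by (rule sum.reindex_bij_witness[where
        j = "\<lambda>(a, b, x, y). (b, a, y, x)" and i = "\<lambda>(a, b, x, y). (b, a, y, x)"])
     (auto simp: conv_set_def algebra_simps)

text \<open>The previous substitution, conjugated by exchanging \<open>(a, x)\<close> with
  \<open>(b, y)\<close>.\<close>

lemma sum_conv_set_shift':
  fixes g :: "nat \<Rightarrow> nat \<Rightarrow> nat \<Rightarrow> nat \<Rightarrow> 'a::comm_monoid_add"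
  shows "(\<Sum>(a, b, x, y) \<in> {(a, b, x, y) \<in> conv_set n. y < x}. g a (a + b) (x - y) y) =
         (\<Sum>(a, b, x, y) \<in> {(a, b, x, y) \<in> conv_set n. a < b}. g a b x y)"
  using sum_conv_set_shift[of "\<lambda>a b x y. g b a y x" n]
    sum_conv_set_swap[where P = "\<lambda>a b x y. y < x" and g = "\<lambda>a b x y. g a (a + b) (x - y) y"]
    sum_conv_set_swap[where P = "\<lambda>a b x y. a < b" and g = g]
  by (simp add: add.commute)

lemma sum_trichotomy:
  fixes u v :: "'b \<Rightarrow> nat" and g :: "'b \<Rightarrow> 'a::comm_monoid_add"
  assumes "finite A"
  shows "sum g A = sum g {t \<in> A. v t < u t} + sum g {t \<in> A. u t < v t} + sum g {t \<in> A. u t = v t}"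
proof -
  have "A = ({t \<in> A. v t < u t} \<union> {t \<in> A. u t < v t}) \<union> {t \<in> A. u t = v t}"
    by auto
  then have "sum g A = sum g (({t \<in> A. v t < u t} \<union> {t \<in> A. u t < v t}) \<union> {t \<in> A. u t = v t})"
    by simp
  also have "\<dots> = sum g {t \<in> A. v t < u t} + sum g {t \<in> A. u t < v t} + sum g {t \<in> A. u t = v t}"
    using assms by (subst sum.union_disjoint, auto)+
  finally show ?thesis .
qed

lemma sum_conv_set_trichotomy:
  fixes g :: "nat \<Rightarrow> nat \<Rightarrow> nat \<Rightarrow> nat \<Rightarrow> 'a::comm_monoid_add"
  shows "(\<Sum>(a, b, x, y) \<in> conv_set n. g a b x y) =
           (\<Sum>(a, b, x, y) \<in> {(a, b, x, y) \<in> conv_set n. b < a}. g a b x y) +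
           (\<Sum>(a, b, x, y) \<in> {(a, b, x, y) \<in> conv_set n. a < b}. g a b x y) +
           (\<Sum>(a, b, x, y) \<in> {(a, b, x, y) \<in> conv_set n. a = b}. g a b x y)"
    and "(\<Sum>(a, b, x, y) \<in> conv_set n. g a b x y) =
           (\<Sum>(a, b, x, y) \<in> {(a, b, x, y) \<in> conv_set n. x < y}. g a b x y) +
           (\<Sum>(a, b, x, y) \<in> {(a, b, x, y) \<in> conv_set n. y < x}. g a b x y) +
           (\<Sum>(a, b, x, y) \<in> {(a, b, x, y) \<in> conv_set n. x = y}. g a b x y)"
proof -
  have eq: "{t \<in> conv_set n. case t of (a, b, x, y) \<Rightarrow> P a b x y} =
            {(a, b, x, y) \<in> conv_set n. P a b x y}" for P
    by auto
  show "(\<Sum>(a, b, x, y) \<in> conv_set n. g a b x y) =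
           (\<Sum>(a, b, x, y) \<in> {(a, b, x, y) \<in> conv_set n. b < a}. g a b x y) +
           (\<Sum>(a, b, x, y) \<in> {(a, b, x, y) \<in> conv_set n. a < b}. g a b x y) +
           (\<Sum>(a, b, x, y) \<in> {(a, b, x, y) \<in> conv_set n. a = b}. g a b x y)"
    using sum_trichotomy[OF finite_conv_set[of n], of "\<lambda>(a, b, x, y). g a b x y"
        "\<lambda>(a, b, x, y). b" "\<lambda>(a, b, x, y). a"]
    unfolding eq[symmetric] by (simp add: split_def)
  show "(\<Sum>(a, b, x, y) \<in> conv_set n. g a b x y) =
           (\<Sum>(a, b, x, y) \<in> {(a, b, x, y) \<in> conv_set n. x < y}. g a b x y) +
           (\<Sum>(a, b, x, y) \<in> {(a, b, x, y) \<in> conv_set n. y < x}. g a b x y) +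
           (\<Sum>(a, b, x, y) \<in> {(a, b, x, y) \<in> conv_set n. x = y}. g a b x y)"
    using sum_trichotomy[OF finite_conv_set[of n], of "\<lambda>(a, b, x, y). g a b x y"
        "\<lambda>(a, b, x, y). y" "\<lambda>(a, b, x, y). x"]
    unfolding eq[symmetric] by (simp add: split_def add.commute eq_commute)
qed

text \<open>
  A special case of the identity of Huard, Ou, Spearman and Williams, for functions that do not depend
  on the last two variables. The substitution \<open>(a, b, x, y) \<mapsto> (a + b, b, x, y - x)\<close> matches the
  part \<open>x < y\<close> of the sum with the part \<open>b < a\<close>, so that everything off the diagonals cancels.
\<close>

lemma liouville_identity:
  fixes f :: "int \<Rightarrow> int \<Rightarrow> 'a::comm_ring_1"
  assumes even: "\<And>a b. f (- a) (- b) = f a b"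
  shows "(\<Sum>(a, b, x, y) \<in> conv_set n. f a b - f a (- int b) + f a (int a - b) - f a (int a + b)
             + f (int b - a) b - f (int a + b) b) =
         (\<Sum>(a, b, x, y) \<in> {(a, b, x, y) \<in> conv_set n. a = b}. f (int a) (int a) + f (int a) 0 + f 0 (int a)) -
         (\<Sum>(a, b, x, y) \<in> {(a, b, x, y) \<in> conv_set n. x = y}.
             f (int a + b) b + f a (int a + b) + f a (- int b))"
proof -
  define G where "G P h = (\<Sum>(a, b, x, y) \<in> {(a, b, x, y) \<in> conv_set n. P a b x y}. h (int a) (int b))"
    for P :: "nat \<Rightarrow> nat \<Rightarrow> nat \<Rightarrow> nat \<Rightarrow> bool" and h :: "int \<Rightarrow> int \<Rightarrow> 'a"
  define S where "S h = (\<Sum>(a, b, x, y) \<in> conv_set n. h (int a) (int b))"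
    for h :: "int \<Rightarrow> int \<Rightarrow> 'a"
  let ?ba = "\<lambda>a b x y. b < (a::nat)" and ?ab = "\<lambda>a b x y. a < (b::nat)"
    and ?eq = "\<lambda>a b x y. a = (b::nat)"
  let ?xy = "\<lambda>a b x y. x < (y::nat)" and ?yx = "\<lambda>a b x y. y < (x::nat)"
    and ?xx = "\<lambda>a b x y. x = (y::nat)"
  have tri1: "S h = G ?ba h + G ?ab h + G ?eq h" for h
    unfolding S_def G_def by (rule sum_conv_set_trichotomy(1))
  have tri2: "S h = G ?xy h + G ?yx h + G ?xx h" for h
    unfolding S_def G_def by (rule sum_conv_set_trichotomy(2))
  have shift: "G ?xy (\<lambda>a b. h (a + b) b) = G ?ba h" for h
    unfolding G_def using sum_conv_set_shift[of "\<lambda>a b x y. h (int a) (int b)"] by simp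
  have shift': "G ?yx (\<lambda>a b. h a (a + b)) = G ?ab h" for h
    unfolding G_def using sum_conv_set_shift'[of "\<lambda>a b x y. h (int a) (int b)"] by simp
  have swap: "G P h = G (\<lambda>a b x y. P b a y x) (\<lambda>a b. h b a)" for P h
    unfolding G_def by (rule sum_conv_set_swap)
  have G_add: "G P (\<lambda>a b. h a b + h' a b) = G P h + G P h'" for P h h'
    unfolding G_def by (simp add: sum.distrib split_def)
  have [simp]: "f (int b - a) (- int a) = f (int a - b) a" for a b
    using even[of "int a - b" "int a"] by simp
  \<comment> \<open>Regions in \<open>a, b\<close> are carried to regions in \<open>x, y\<close>: in
    \<open>e1\<close> and \<open>e2\<close> by a shift and an exchange, in \<open>e3\<close> and
    \<open>e4\<close> by a shift alone. Evenness enters \<open>e4\<close> as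
    \<open>f (- a) b = f a (- b)\<close>.\<close>
  have e1: "G ?ba (\<lambda>a b. f a (a - b)) = G ?yx (\<lambda>a b. f (a + b) b)"
    using shift[of "\<lambda>a b. f a (a - b)"] swap[of ?yx "\<lambda>a b. f (a + b) b"] by (simp add: add.commute)
  have e2: "G ?ab (\<lambda>a b. f (b - a) b) = G ?xy (\<lambda>a b. f a (a + b))"
    using shift'[of "\<lambda>a b. f (b - a) b"] swap[of ?xy "\<lambda>a b. f a (a + b)"] by (simp add: add.commute)
  have e3: "G ?ab (\<lambda>a b. f a (a - b)) = G ?yx (\<lambda>a b. f a (- b))"
    using shift'[of "\<lambda>a b. f a (a - b)"] by simp
  have e4: "G ?ba (\<lambda>a b. f (b - a) b) = G ?xy (\<lambda>a b. f a (- b))"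
  proof -
    have "f (- a) b = f a (- b)" for a b using even[of a "- b"] by simp
    then show ?thesis using shift[of "\<lambda>a b. f (b - a) b"] by simp
  qed
  have "(\<Sum>(a, b, x, y) \<in> conv_set n. f a b - f a (- int b) + f a (int a - b) - f a (int a + b)
             + f (int b - a) b - f (int a + b) b) =
        S f - S (\<lambda>a b. f a (- b)) + S (\<lambda>a b. f a (a - b)) - S (\<lambda>a b. f a (a + b))
         + S (\<lambda>a b. f (b - a) b) - S (\<lambda>a b. f (a + b) b)"
    unfolding S_def by (simp add: sum.distrib sum_subtractf split_def)
  \<comment> \<open>The sums with a plus sign are cut along \<open>a = b\<close>, those with a minus
    sign along \<open>x = y\<close>. Every off-diagonal piece then meets its negative.\<close>
  also have "\<dots> = (G ?ba f + G ?ab f + G ?eq f)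
      - (G ?xy (\<lambda>a b. f a (- b)) + G ?yx (\<lambda>a b. f a (- b)) + G ?xx (\<lambda>a b. f a (- b)))
      + (G ?ba (\<lambda>a b. f a (a - b)) + G ?ab (\<lambda>a b. f a (a - b)) + G ?eq (\<lambda>a b. f a (a - b)))
      - (G ?xy (\<lambda>a b. f a (a + b)) + G ?yx (\<lambda>a b. f a (a + b)) + G ?xx (\<lambda>a b. f a (a + b)))
      + (G ?ba (\<lambda>a b. f (b - a) b) + G ?ab (\<lambda>a b. f (b - a) b) + G ?eq (\<lambda>a b. f (b - a) b))
      - (G ?xy (\<lambda>a b. f (a + b) b) + G ?yx (\<lambda>a b. f (a + b) b) + G ?xx (\<lambda>a b. f (a + b) b))"
    by (simp only: tri1[of f] tri2[of "\<lambda>a b. f a (- b)"] tri1[of "\<lambda>a b. f a (a - b)"]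
          tri2[of "\<lambda>a b. f a (a + b)"] tri1[of "\<lambda>a b. f (b - a) b"] tri2[of "\<lambda>a b. f (a + b) b"])
  also have "\<dots> = G ?eq f + G ?eq (\<lambda>a b. f a (a - b)) + G ?eq (\<lambda>a b. f (b - a) b) -
      (G ?xx (\<lambda>a b. f (a + b) b) + G ?xx (\<lambda>a b. f a (a + b)) + G ?xx (\<lambda>a b. f a (- b)))"
    unfolding e1 e2 e3 e4 shift shift' by (simp add: algebra_simps)
  also have "\<dots> = G ?eq (\<lambda>a b. f a b + f a (a - b) + f (b - a) b) -
      G ?xx (\<lambda>a b. f (a + b) b + f a (a + b) + f a (- b))"
    by (simp only: G_add)
  also have "G ?eq (\<lambda>a b. f a b + f a (a - b) + f (b - a) b) = G ?eq (\<lambda>a b. f a a + f a 0 + f 0 a)"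
    unfolding G_def by (rule sum.cong) auto
  finally show ?thesis unfolding G_def .
qed

text \<open>For \<open>a = b = d\<close> the equation reads \<open>d (x + y) = n\<close>, which
  leaves \<open>n div d - 1\<close> choices of \<open>x\<close>.\<close>

lemma sum_conv_set_diag_ab:
  fixes h :: "nat \<Rightarrow> 'a::comm_ring_1"
  assumes n: "n > 0"
  shows "(\<Sum>(a, b, x, y) \<in> {(a, b, x, y) \<in> conv_set n. a = b}. h a) =
         (\<Sum>d | d dvd n. (of_nat (n div d) - 1) * h d)"
proof -
  have "(\<Sum>d | d dvd n. (of_nat (n div d) - 1) * h d) = (\<Sum>d | d dvd n. \<Sum>x\<in>{0<..<n div d}. h d)"
  proof (rule sum.cong)
    fix d assume "d \<in> {d. d dvd n}"
    then have "n div d \<ge> 1" using n by (auto simp: Suc_le_eq dvd_imp_le dvd_div_eq_0_iff)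
    then show "(of_nat (n div d) - 1) * h d = (\<Sum>x\<in>{0<..<n div d}. h d)"
      by (simp add: of_nat_diff)
  qed auto
  also have "\<dots> = (\<Sum>(d, x) \<in> (SIGMA d:{d. d dvd n}. {0<..<n div d}). h d)"
    using n by (subst sum.Sigma) auto
  also have "\<dots> = (\<Sum>(a, b, x, y) \<in> {(a, b, x, y) \<in> conv_set n. a = b}. h a)"
    by (rule sum.reindex_bij_witness[where
        i = "\<lambda>(a, b, x, y). (a, x)" and j = "\<lambda>(d, x). (d, d, x, n div d - x)"])
       (use n in \<open>auto simp: conv_set_def dvd_def simp flip: distrib_left\<close>)
  finally show ?thesis ..
qed

text \<open>For \<open>x = y\<close> the equation reads \<open>(a + b) x = n\<close>, so
  \<open>d = a + b\<close> is a divisor and \<open>a\<close> is free below it.\<close>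

lemma sum_conv_set_diag_xy:
  fixes h :: "nat \<Rightarrow> nat \<Rightarrow> 'a::comm_ring_1"
  assumes n: "n > 0"
  shows "(\<Sum>(a, b, x, y) \<in> {(a, b, x, y) \<in> conv_set n. x = y}. h a b) =
         (\<Sum>d | d dvd n. \<Sum>a\<in>{0<..<d}. h a (d - a))"
proof -
  have "(\<Sum>d | d dvd n. \<Sum>a\<in>{0<..<d}. h a (d - a)) =
        (\<Sum>(d, a) \<in> (SIGMA d:{d. d dvd n}. {0<..<d}). h a (d - a))"
    using n by (subst sum.Sigma) auto
  also have "\<dots> = (\<Sum>(a, b, x, y) \<in> {(a, b, x, y) \<in> conv_set n. x = y}. h a b)"
    by (rule sum.reindex_bij_witness[where
        i = "\<lambda>(a, b, x, y). (a + b, a)" and j = "\<lambda>(d, a). (a, d - a, n div d, n div d)"])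
       (use n in \<open>auto simp: conv_set_def dvd_def simp flip: distrib_right\<close>)
  finally show ?thesis ..
qed

section \<open>Generating series of divisor sums\<close>

definition sigma_fps :: "nat \<Rightarrow> complex fps" where
  "sigma_fps k = Abs_fps (\<lambda>n. of_nat (divisor_sum k n))"

text \<open>Every number divides 0, and a sum over an infinite set is 0 by convention. Hence
  \<open>sigma_fps\<close> has no constant term.\<close>

lemma divisor_sum_0 [simp]: "divisor_sum k 0 = 0"
  by (simp add: divisor_sum_def)

lemma sigma_fps_nth [simp]: "sigma_fps k $ n = of_nat (divisor_sum k n)"
  by (simp add: sigma_fps_def)

text \<open>With \<open>m = a x\<close>, a quadruple is a splitting of \<open>n\<close> into
  \<open>m\<close> and \<open>n - m\<close> together with a divisor of each part. The end terms
  \<open>m = 0\<close> and \<open>m = n\<close> of the Cauchy product vanish by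
  \<open>divisor_sum_0\<close>.\<close>

lemma sum_conv_set_power:
  "(\<Sum>(a, b, x, y) \<in> conv_set n. of_nat a ^ i * of_nat b ^ j) = (sigma_fps i * sigma_fps j) $ n"
proof -
  have "(sigma_fps i * sigma_fps j) $ n =
        (\<Sum>m\<in>{0<..<n}. of_nat (divisor_sum i m) * of_nat (divisor_sum j (n - m)))"
    unfolding fps_mult_nth sigma_fps_nth
  proof (rule sum.mono_neutral_right)
    show "\<forall>m\<in>{0..n} - {0<..<n}.
      complex_of_nat (divisor_sum i m) * complex_of_nat (divisor_sum j (n - m)) = 0"
    proof
      fix m assume "m \<in> {0..n} - {0<..<n}"
      then have "m = 0 \<or> m = n" by auto
      then show "complex_of_nat (divisor_sum i m) * complex_of_nat (divisor_sum j (n - m)) = 0"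
        by auto
    qed
  qed auto
  also have "\<dots> = (\<Sum>m\<in>{0<..<n}. \<Sum>(a, b)\<in>{d. d dvd m} \<times> {d. d dvd (n - m)}. of_nat a ^ i * of_nat b ^ j)"
    by (simp add: divisor_sum_def sum_product sum.cartesian_product)
  also have "\<dots> = (\<Sum>(m, a, b) \<in> (SIGMA m:{0<..<n}. {d. d dvd m} \<times> {d. d dvd (n - m)}).
      of_nat a ^ i * of_nat b ^ j)"
    by (subst sum.Sigma) auto
  also have "\<dots> = (\<Sum>(a, b, x, y) \<in> conv_set n. of_nat a ^ i * of_nat b ^ j)"
    by (rule sum.reindex_bij_witness[where
        i = "\<lambda>(a, b, x, y). (a * x, a, b)" and j = "\<lambda>(m, a, b). (a, b, m div a, (n - m) div b)"])
       (auto simp: conv_set_def dvd_div_eq_0_iff dest: dvd_pos_nat intro!: Nat.gr0I)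
  finally show ?thesis ..
qed

section \<open>Ramanujan's differential equations as formal power series\<close>

text \<open>This and the next three are Faulhaber's formulas; the sums stop before \<open>d\<close>,
  whence the minus sign of the second term.\<close>

lemma sum_power_3: "(\<Sum>a<d. of_nat a ^ 3 :: complex) = of_nat d ^ 4 / 4 - of_nat d ^ 3 / 2 + of_nat d ^ 2 / 4"
proof (induction d)
  case (Suc d)
  then show ?case unfolding sum.lessThan_Suc Suc.IH by (simp add: field_simps power_numeral_reduce)
qed simp

lemma sum_power_4:
  "(\<Sum>a<d. of_nat a ^ 4 :: complex) = of_nat d ^ 5 / 5 - of_nat d ^ 4 / 2 + of_nat d ^ 3 / 3 - of_nat d / 30"
proof (induction d)
  case (Suc d)
  then show ?case unfolding sum.lessThan_Suc Suc.IH by (simp add: field_simps power_numeral_reduce)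
qed simp

lemma sum_power_5:
  "(\<Sum>a<d. of_nat a ^ 5 :: complex) =
     of_nat d ^ 6 / 6 - of_nat d ^ 5 / 2 + 5 / 12 * of_nat d ^ 4 - of_nat d ^ 2 / 12"
proof (induction d)
  case (Suc d)
  then show ?case unfolding sum.lessThan_Suc Suc.IH by (simp add: field_simps power_numeral_reduce)
qed simp

lemma sum_power_6:
  "(\<Sum>a<d. of_nat a ^ 6 :: complex) =
     of_nat d ^ 7 / 7 - of_nat d ^ 6 / 2 + of_nat d ^ 5 / 2 - of_nat d ^ 3 / 6 + of_nat d / 42"
proof (induction d)
  case (Suc d)
  then show ?case unfolding sum.lessThan_Suc Suc.IH by (simp add: field_simps power_numeral_reduce)
qed simp

lemma sum_greaterThanLessThan_power:
  "k > 0 \<Longrightarrow> (\<Sum>a\<in>{0<..<d}. of_nat a ^ k) = (\<Sum>a<d. of_nat a ^ k :: complex)"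
  by (rule sum.mono_neutral_left) auto

lemma sum_greaterThanLessThan_reflect_power:
  assumes "k > 0"
  shows "(\<Sum>a\<in>{0<..<d}. (of_nat d - of_nat a) ^ k) = (\<Sum>a<d. of_nat a ^ k :: complex)"
proof -
  have "(\<Sum>a\<in>{0<..<d}. (of_nat d - of_nat a) ^ k) = (\<Sum>a\<in>{0<..<d}. of_nat a ^ k :: complex)"
    by (rule sum.reindex_bij_witness[where i = "\<lambda>a. d - a" and j = "\<lambda>a. d - a"]) (auto simp: of_nat_diff)
  with assms show ?thesis by (simp add: sum_greaterThanLessThan_power)
qed

lemma of_nat_divisor_sum: "of_nat (divisor_sum k n) = (\<Sum>d | d dvd n. of_nat d ^ k :: complex)"
  by (simp add: divisor_sum_def)

lemma liouville_identity_divisors: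
  fixes f :: "int \<Rightarrow> int \<Rightarrow> complex"
  assumes even: "\<And>a b. f (- a) (- b) = f a b" and n: "n > 0"
  shows "(\<Sum>(a, b, x, y) \<in> conv_set n. f a b - f a (- int b) + f a (int a - b) - f a (int a + b)
             + f (int b - a) b - f (int a + b) b) =
         (\<Sum>d | d dvd n. (of_nat (n div d) - 1) * (f d d + f d 0 + f 0 d)
            - (\<Sum>a\<in>{0<..<d}. f d (int d - int a) + f a d + f a (int a - int d)))"
proof -
  have "(\<Sum>d | d dvd n. \<Sum>a\<in>{0<..<d}. f (int a + int (d - a)) (int (d - a)) + f a (int a + int (d - a))
            + f a (- int (d - a))) =
        (\<Sum>d | d dvd n. \<Sum>a\<in>{0<..<d}. f d (int d - int a) + f a d + f a (int a - int d))"
    by (intro sum.cong refl) (simp add: of_nat_diff)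
  then show ?thesis
    unfolding liouville_identity[of f, OF even]
    by (simp add: sum_conv_set_diag_ab[OF n, of "\<lambda>a. f (int a) (int a) + f (int a) 0 + f 0 (int a)"]
          sum_conv_set_diag_xy[OF n, of "\<lambda>a b. f (int a + int b) (int b) + f (int a) (int a + int b) + f (int a) (- int b)"]
          sum_subtractf)
qed

lemma sum_conv_set_power':
  "(\<Sum>t\<in>conv_set n. case t of (a, b, x, y) \<Rightarrow> c * (of_nat a ^ i * of_nat b ^ j)) =
     c * (sigma_fps i * sigma_fps j) $ n"
  unfolding sum_conv_set_power[symmetric] by (simp add: sum_distrib_left split_def)

text \<open>Multiplied by -24, this is the coefficient form of
  \<open>3 DE4 = E2 E4 - E6\<close>.\<close>

lemma sigma_1_3_convolution:
  "240 * (sigma_fps 1 * sigma_fps 3) $ n =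
     21 * sigma_fps 5 $ n + (10 - 30 * of_nat n) * sigma_fps 3 $ n - sigma_fps 1 $ n"
proof (cases "n = 0")
  case False
  \<comment> \<open>For \<open>b^4\<close> only \<open>f a (a - b) - f a (a + b)\<close> survives on
    the left, and \<open>(a - b)^4 - (a + b)^4 = - 8 a^3 b - 8 a b^3\<close>.\<close>
  define f where "f a b = complex_of_int b ^ 4" for a b :: int
  have "- 16 * (sigma_fps 1 * sigma_fps 3) $ n =
      - 8 * (sigma_fps 3 * sigma_fps 1) $ n + - 8 * (sigma_fps 1 * sigma_fps 3) $ n"
    by (simp add: mult.commute)
  also have "\<dots> = (\<Sum>(a, b, x, y) \<in> conv_set n. - 8 * (of_nat a ^ 3 * of_nat b ^ 1)
      + - 8 * (of_nat a ^ 1 * of_nat b ^ 3))"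
    unfolding sum_conv_set_power'[symmetric] sum.distrib[symmetric] by (rule sum.cong) auto
  also have "\<dots> = (\<Sum>(a, b, x, y) \<in> conv_set n. f a b - f a (- int b) + f a (int a - b) - f a (int a + b)
             + f (int b - a) b - f (int a + b) b)"
    by (intro sum.cong refl) (auto simp: f_def power_numeral_reduce algebra_simps)
  also have "\<dots> = (\<Sum>d | d dvd n. (of_nat (n div d) - 1) * (f d d + f d 0 + f 0 d)
            - (\<Sum>a\<in>{0<..<d}. f d (int d - int a) + f a d + f a (int a - int d)))"
    using False by (intro liouville_identity_divisors) (auto simp: f_def)
  \<comment> \<open>The first diagonal gives \<open>2 n d^3 - 2 d^4\<close>; its last term cancels
    against the second diagonal, so no even power of \<open>d\<close> is left.\<close>
  also have "\<dots> = (\<Sum>d | d dvd n. 2 * of_nat n * of_nat d ^ 3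
      - (7 / 5 * of_nat d ^ 5 + 2 / 3 * of_nat d ^ 3 - 1 / 15 * of_nat d))"
  proof (intro sum.cong refl)
    fix d assume "d \<in> {d. d dvd n}"
    then have nd: "complex_of_nat n = of_nat d * of_nat (n div d)"
      by (metis dvd_mult_div_cancel mem_Collect_eq of_nat_mult)
    from \<open>d \<in> _\<close> False have d: "d \<ge> 1" by (auto simp: Suc_le_eq intro!: Nat.gr0I)
    have "f d (int d - int a) + f a d + f a (int a - int d) =
        2 * (of_nat d - of_nat a) ^ 4 + of_nat d ^ 4" for a
      by (simp add: f_def power_numeral_reduce algebra_simps)
    then have off: "(\<Sum>a\<in>{0<..<d}. f d (int d - int a) + f a d + f a (int a - int d)) =
        2 * (\<Sum>a<d. of_nat a ^ 4) + (of_nat d - 1) * of_nat d ^ 4"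
      using d by (simp add: sum.distrib sum_greaterThanLessThan_reflect_power of_nat_diff
          flip: sum_distrib_left)
    show "(of_nat (n div d) - 1) * (f d d + f d 0 + f 0 d)
            - (\<Sum>a\<in>{0<..<d}. f d (int d - int a) + f a d + f a (int a - int d)) =
        2 * of_nat n * of_nat d ^ 3 - (7 / 5 * of_nat d ^ 5 + 2 / 3 * of_nat d ^ 3 - 1 / 15 * of_nat d)"
      unfolding off nd sum_power_4 by (simp add: f_def field_simps power_numeral_reduce)
  qed
  also have "\<dots> = 2 * of_nat n * sigma_fps 3 $ n
      - (7 / 5 * sigma_fps 5 $ n + 2 / 3 * sigma_fps 3 $ n - 1 / 15 * sigma_fps 1 $ n)"
    by (simp add: of_nat_divisor_sum sum_subtractf sum.distrib sum_distrib_left)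
  finally have conv: "- 16 * (sigma_fps 1 * sigma_fps 3) $ n = 2 * of_nat n * sigma_fps 3 $ n
      - (7 / 5 * sigma_fps 5 $ n + 2 / 3 * sigma_fps 3 $ n - 1 / 15 * sigma_fps 1 $ n)" .
  have "240 * (sigma_fps 1 * sigma_fps 3) $ n = - 15 * (- 16 * (sigma_fps 1 * sigma_fps 3) $ n)"
    by simp
  then show ?thesis unfolding conv by (simp add: algebra_simps)
qed simp

text \<open>
  Among the even \<open>f = \<alpha> b\<^sup>6 + \<beta> a\<^sup>3 b\<^sup>3\<close>, this choice of \<open>\<alpha>\<close> and \<open>\<beta>\<close> produces the combination of
  convolutions from which \<open>\<sigma>\<^sub>7\<close> cancels.
\<close>

lemma sigma_1_5_3_3_convolution:
  "504 * (sigma_fps 1 * sigma_fps 5) $ n - 2400 * (sigma_fps 3 * sigma_fps 3) $ n =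
     sigma_fps 1 $ n + 20 * sigma_fps 3 $ n + 21 * sigma_fps 5 $ n - 42 * of_nat n * sigma_fps 5 $ n"
proof (cases "n = 0")
  case False
  define f where "f a b = 69 * complex_of_int b ^ 6 - 180 * of_int a ^ 3 * of_int b ^ 3" for a b :: int
  have "504 * (sigma_fps 1 * sigma_fps 5) $ n - 2400 * (sigma_fps 3 * sigma_fps 3) $ n =
      252 * (sigma_fps 5 * sigma_fps 1) $ n + 252 * (sigma_fps 1 * sigma_fps 5) $ n
      + - 2400 * (sigma_fps 3 * sigma_fps 3) $ n"
    by (simp add: mult.commute)
  also have "\<dots> = (\<Sum>(a, b, x, y) \<in> conv_set n. 252 * (of_nat a ^ 5 * of_nat b ^ 1)
      + 252 * (of_nat a ^ 1 * of_nat b ^ 5) + - 2400 * (of_nat a ^ 3 * of_nat b ^ 3))"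
    unfolding sum_conv_set_power'[symmetric] sum.distrib[symmetric] by (rule sum.cong) auto
  also have "\<dots> = (\<Sum>(a, b, x, y) \<in> conv_set n. f a b - f a (- int b) + f a (int a - b) - f a (int a + b)
             + f (int b - a) b - f (int a + b) b)"
    by (intro sum.cong refl) (auto simp: f_def power_numeral_reduce algebra_simps)
  also have "\<dots> = (\<Sum>d | d dvd n. (of_nat (n div d) - 1) * (f d d + f d 0 + f 0 d)
            - (\<Sum>a\<in>{0<..<d}. f d (int d - int a) + f a d + f a (int a - int d)))"
    using False by (intro liouville_identity_divisors) (auto simp: f_def)
  also have "\<dots> = (\<Sum>d | d dvd n. of_nat d + 20 * of_nat d ^ 3 + 21 * of_nat d ^ 5
      - 42 * of_nat n * of_nat d ^ 5)"
  proof (intro sum.cong refl)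
    fix d assume "d \<in> {d. d dvd n}"
    then have nd: "complex_of_nat n = of_nat d * of_nat (n div d)"
      by (metis dvd_mult_div_cancel mem_Collect_eq of_nat_mult)
    from \<open>d \<in> _\<close> False have d: "d \<ge> 1" by (auto simp: Suc_le_eq intro!: Nat.gr0I)
    have "f d (int d - int a) + f a d + f a (int a - int d) =
        138 * (of_nat d - of_nat a) ^ 6 + 69 * of_nat d ^ 6 - 180 * of_nat d ^ 3 * (of_nat d - of_nat a) ^ 3
        - 180 * of_nat a ^ 6 + 540 * of_nat d * of_nat a ^ 5 - 540 * of_nat d ^ 2 * of_nat a ^ 4" for a
      by (simp add: f_def power_numeral_reduce algebra_simps)
    then have off: "(\<Sum>a\<in>{0<..<d}. f d (int d - int a) + f a d + f a (int a - int d)) =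
        138 * (\<Sum>a<d. of_nat a ^ 6) + 69 * (of_nat d - 1) * of_nat d ^ 6
        - 180 * of_nat d ^ 3 * (\<Sum>a<d. of_nat a ^ 3) - 180 * (\<Sum>a<d. of_nat a ^ 6)
        + 540 * of_nat d * (\<Sum>a<d. of_nat a ^ 5) - 540 * of_nat d ^ 2 * (\<Sum>a<d. of_nat a ^ 4)"
      using d by (simp add: sum.distrib sum_subtractf sum_greaterThanLessThan_reflect_power
          sum_greaterThanLessThan_power of_nat_diff flip: sum_distrib_left)
    show "(of_nat (n div d) - 1) * (f d d + f d 0 + f 0 d)
            - (\<Sum>a\<in>{0<..<d}. f d (int d - int a) + f a d + f a (int a - int d)) =
        of_nat d + 20 * of_nat d ^ 3 + 21 * of_nat d ^ 5 - 42 * of_nat n * of_nat d ^ 5"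
      unfolding off nd sum_power_3 sum_power_4 sum_power_5 sum_power_6
      by (simp add: f_def field_simps power_numeral_reduce)
  qed
  also have "\<dots> = sigma_fps 1 $ n + 20 * sigma_fps 3 $ n + 21 * sigma_fps 5 $ n
      - 42 * of_nat n * sigma_fps 5 $ n"
    by (simp add: of_nat_divisor_sum sum_subtractf sum.distrib sum_distrib_left)
  finally show ?thesis .
qed simp

section \<open>Eisenstein series as formal power series\<close>

definition eis2_fps :: "complex fps" where "eis2_fps = 1 - fps_const 24 * sigma_fps 1"
definition eis4_fps :: "complex fps" where "eis4_fps = 1 + fps_const 240 * sigma_fps 3"
definition eis6_fps :: "complex fps" where "eis6_fps = 1 - fps_const 504 * sigma_fps 5"

text \<open>Multiplying \<open>fps_deriv\<close> by \<open>fps_X\<close> gives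
  \<open>q d/dq\<close>, the counterpart of \<open>Dz\<close> under
  \<open>q = nome z\<close>.\<close>

lemma fps_X_times_deriv_nth: "(fps_X * fps_deriv F) $ n = of_nat n * F $ n"
  by (cases n) auto

text \<open>Lets the constant term 1 of the Eisenstein series stay symbolic as \<open>1 $ n\<close>,
  so that the coefficient comparisons need no separate case \<open>n = 0\<close>.\<close>

lemma nat_times_one_nth: "complex_of_nat n * 1 $ n = 0"
  by (cases n) auto

lemma ramanujan_eis4: "fps_const 3 * (fps_X * fps_deriv eis4_fps) = eis2_fps * eis4_fps - eis6_fps"
proof (rule fps_ext)
  fix n
  note nth = fps_add_nth fps_sub_nth fps_mult_left_const_nth fps_X_times_deriv_nth
  have "eis2_fps * eis4_fps = 1 - fps_const 24 * sigma_fps 1 + fps_const 240 * sigma_fps 3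
      - fps_const (24 * 240) * (sigma_fps 1 * sigma_fps 3)"
    unfolding eis2_fps_def eis4_fps_def fps_const_mult[symmetric] by (simp add: algebra_simps)
  then have "(eis2_fps * eis4_fps) $ n = 1 $ n - 24 * sigma_fps 1 $ n + 240 * sigma_fps 3 $ n
      - 24 * 240 * (sigma_fps 1 * sigma_fps 3) $ n"
    by (simp only: nth)
  moreover have "eis4_fps $ n = 1 $ n + 240 * sigma_fps 3 $ n" "eis6_fps $ n = 1 $ n - 504 * sigma_fps 5 $ n"
    by (simp_all only: eis4_fps_def eis6_fps_def nth)
  ultimately show
    "(fps_const 3 * (fps_X * fps_deriv eis4_fps)) $ n = (eis2_fps * eis4_fps - eis6_fps) $ n"
    using sigma_1_3_convolution[of n] nat_times_one_nth[of n] unfolding nth by algebra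
qed

lemma ramanujan_eis6: "fps_const 2 * (fps_X * fps_deriv eis6_fps) = eis2_fps * eis6_fps - eis4_fps ^ 2"
proof (rule fps_ext)
  fix n
  note nth = fps_add_nth fps_sub_nth fps_mult_left_const_nth fps_X_times_deriv_nth
  have "eis2_fps * eis6_fps = 1 - fps_const 24 * sigma_fps 1 - fps_const 504 * sigma_fps 5
      + fps_const (24 * 504) * (sigma_fps 1 * sigma_fps 5)"
    unfolding eis2_fps_def eis6_fps_def fps_const_mult[symmetric] by (simp add: algebra_simps)
  then have "(eis2_fps * eis6_fps) $ n = 1 $ n - 24 * sigma_fps 1 $ n - 504 * sigma_fps 5 $ n
      + 24 * 504 * (sigma_fps 1 * sigma_fps 5) $ n"
    by (simp only: nth)
  moreover have "eis4_fps ^ 2 = 1 + fps_const 240 * sigma_fps 3 + fps_const 240 * sigma_fps 3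
      + fps_const (240 * 240) * (sigma_fps 3 * sigma_fps 3)"
    unfolding eis4_fps_def fps_const_mult[symmetric] by (simp add: algebra_simps power2_eq_square)
  then have "(eis4_fps ^ 2) $ n = 1 $ n + 240 * sigma_fps 3 $ n + 240 * sigma_fps 3 $ n
      + 240 * 240 * (sigma_fps 3 * sigma_fps 3) $ n"
    by (simp only: nth)
  moreover have "eis6_fps $ n = 1 $ n - 504 * sigma_fps 5 $ n"
    by (simp only: eis6_fps_def nth)
  ultimately show
    "(fps_const 2 * (fps_X * fps_deriv eis6_fps)) $ n = (eis2_fps * eis6_fps - eis4_fps ^ 2) $ n"
    using sigma_1_5_3_3_convolution[of n] nat_times_one_nth[of n] unfolding nth by algebra
qed

text \<open>Both of Ramanujan's equations contain \<open>E2\<close>; with the weights 4 and 6 as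
  factors its contributions \<open>2 E2 E4 E6\<close> cancel.\<close>

lemma eis_fps_rankin_cohen:
  "4 * eis4_fps * (fps_X * fps_deriv eis6_fps) - 6 * eis6_fps * (fps_X * fps_deriv eis4_fps) =
   - 2 * (eis4_fps ^ 3 - eis6_fps ^ 2)"
proof -
  have c: "fps_const (numeral k) = (numeral k :: complex fps)" for k
    by (simp add: numeral_fps_const)
  have "4 * eis4_fps * (fps_X * fps_deriv eis6_fps) - 6 * eis6_fps * (fps_X * fps_deriv eis4_fps) =
     2 * eis4_fps * (fps_const 2 * (fps_X * fps_deriv eis6_fps))
     - 2 * eis6_fps * (fps_const 3 * (fps_X * fps_deriv eis4_fps))"
    by (simp add: c algebra_simps)
  also have "\<dots> = - 2 * (eis4_fps ^ 3 - eis6_fps ^ 2)"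
    unfolding ramanujan_eis4 ramanujan_eis6 by (simp add: algebra_simps power_numeral_reduce)
  finally show ?thesis .
qed


lemma divisor_sum_le: "divisor_sum k n \<le> n ^ Suc k"
proof (cases "n = 0")
  case False
  have "divisor_sum k n \<le> (\<Sum>d | d dvd n. n ^ k)"
    unfolding divisor_sum_def using False by (intro sum_mono power_mono) (auto intro: dvd_imp_le)
  also have "\<dots> \<le> (\<Sum>d\<in>{1..n}. n ^ k)"
    using False by (intro sum_mono2) (auto intro: dvd_imp_le simp: Suc_le_eq intro!: Nat.gr0I)
  finally show ?thesis by simp
qed auto

text \<open>The coefficients are at most \<open>n^(k + 1)\<close>, and the series with those
  coefficients has radius 1 by the ratio test.\<close>

lemma conv_radius_sigma_fps: "fps_conv_radius (sigma_fps k) \<ge> 1"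
  unfolding fps_conv_radius_def
proof (rule conv_radius_geI_ex')
  fix r :: real assume r: "0 < r" "ereal r < 1"
  have "(\<lambda>n. (real n / real (Suc n)) ^ Suc k) \<longlonglongrightarrow> 1 ^ Suc k"
    by (intro tendsto_power LIMSEQ_n_over_Suc_n)
  then have "conv_radius (\<lambda>n. real n ^ Suc k) = ereal 1"
    by (intro conv_radius_ratio_limit_nonzero[where c = 1])
       (simp_all add: power_divide del: power_Suc of_nat_Suc)
  then have "summable (\<lambda>n. norm (real n ^ Suc k * r ^ n))"
    using r by (intro abs_summable_in_conv_radius) simp
  then have "summable (\<lambda>n. norm (of_nat n ^ Suc k * of_real r ^ n :: complex))"
    by (simp add: norm_mult norm_power abs_mult power_abs)
  then show "summable (\<lambda>n. sigma_fps k $ n * of_real r ^ n)"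
  proof (rule summable_comparison_test')
    fix n :: nat
    have "norm (sigma_fps k $ n) \<le> real n ^ Suc k"
      using divisor_sum_le[of k n] by (simp flip: of_nat_power of_nat_mult)
    then show "norm (sigma_fps k $ n * of_real r ^ n) \<le> norm (of_nat n ^ Suc k * of_real r ^ n :: complex)"
      using r by (simp add: norm_mult norm_power mult_right_mono)
  qed
qed

section \<open>The Eisenstein series on the upper half-plane\<close>

lemma conv_radius_eis4_fps: "fps_conv_radius eis4_fps \<ge> 1"
  and conv_radius_eis6_fps: "fps_conv_radius eis6_fps \<ge> 1"
proof -
  have "1 \<le> fps_conv_radius (1 + fps_const 240 * sigma_fps 3)"
    by (rule order.trans[OF _ fps_conv_radius_add]) (simp add: fps_conv_radius_cmult_left conv_radius_sigma_fps)
  then show "fps_conv_radius eis4_fps \<ge> 1" by (simp add: eis4_fps_def)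
  have "1 \<le> fps_conv_radius (1 - fps_const 504 * sigma_fps 5)"
    by (rule order.trans[OF _ fps_conv_radius_diff]) (simp add: fps_conv_radius_cmult_left conv_radius_sigma_fps)
  then show "fps_conv_radius eis6_fps \<ge> 1" by (simp add: eis6_fps_def)
qed

lemma norm_nome_less_1: "Im z > 0 \<Longrightarrow> ereal (norm (nome z)) < 1"
  by (simp add: nome_def norm_exp)

lemma suminf_sigma_fps:
  assumes "ereal (norm q) < 1"
  shows "(\<Sum>n. of_nat (divisor_sum k (Suc n)) * q ^ Suc n) = eval_fps (sigma_fps k) q"
proof -
  have "summable (\<lambda>n. sigma_fps k $ n * q ^ n)"
    using assms conv_radius_sigma_fps[of k] by (intro summable_fps) (rule less_le_trans)
  from suminf_split_head[OF this] show ?thesis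
    by (simp add: eval_fps_def)
qed

lemma eis4_eq_eval_fps: "Im z > 0 \<Longrightarrow> eis4 z = eval_fps eis4_fps (nome z)"
  and eis6_eq_eval_fps: "Im z > 0 \<Longrightarrow> eis6 z = eval_fps eis6_fps (nome z)"
proof -
  assume "Im z > 0"
  note q = norm_nome_less_1[OF this]
  have r: "ereal (norm (nome z)) < fps_conv_radius (sigma_fps k)"
    "ereal (norm (nome z)) < fps_conv_radius (fps_const c * sigma_fps k)" for k and c :: complex
  proof -
    show r: "ereal (norm (nome z)) < fps_conv_radius (sigma_fps k)"
      using q conv_radius_sigma_fps by (rule less_le_trans)
    show "ereal (norm (nome z)) < fps_conv_radius (fps_const c * sigma_fps k)"
      using r by (cases "c = 0") (simp_all add: fps_conv_radius_cmult_left)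
  qed
  show "eis4 z = eval_fps eis4_fps (nome z)"
    using r unfolding eis4_def eis4_fps_def suminf_sigma_fps[OF q]
    by (simp add: eval_fps_add eval_fps_mult)
  show "eis6 z = eval_fps eis6_fps (nome z)"
    using r unfolding eis6_def eis6_fps_def suminf_sigma_fps[OF q]
    by (simp add: eval_fps_diff eval_fps_mult)
qed

lemma eval_fps_nome_has_field_derivative:
  assumes z: "Im z > 0" and F: "fps_conv_radius F \<ge> 1"
    and eq: "\<And>w. Im w > 0 \<Longrightarrow> f w = eval_fps F (nome w)"
  shows "(f has_field_derivative 2 * of_real pi * \<i> * eval_fps (fps_X * fps_deriv F) (nome z)) (at z)"
proof -
  have r: "ereal (norm (nome z)) < fps_conv_radius F"
    using norm_nome_less_1[OF z] F by (rule less_le_trans)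
  then have r': "ereal (norm (nome z)) < fps_conv_radius (fps_deriv F)"
    using fps_conv_radius_deriv by (rule less_le_trans)
  have nome: "(nome has_field_derivative nome z * (2 * of_real pi * \<i>)) (at z)"
    unfolding nome_def by (auto intro!: derivative_eq_intros)
  have "((\<lambda>w. eval_fps F (nome w)) has_field_derivative
      eval_fps (fps_deriv F) (nome z) * (nome z * (2 * of_real pi * \<i>))) (at z)"
    by (rule DERIV_chain2[OF has_field_derivative_eval_fps nome]) (rule r)
  also have "eval_fps (fps_deriv F) (nome z) * (nome z * (2 * of_real pi * \<i>)) =
      2 * of_real pi * \<i> * eval_fps (fps_X * fps_deriv F) (nome z)"
    using r' by (simp add: eval_fps_mult)
  \<comment> \<open>The series represents \<open>f\<close> only on the half-plane; since that is
    open, the derivative carries over.\<close>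
  finally show ?thesis
  proof (rule has_field_derivative_transform_within_open)
    show "open {w. Im w > 0}" by (rule open_halfspace_Im_gt)
  qed (use z eq in auto)
qed

lemma eis4_has_field_derivative:
  "Im z > 0 \<Longrightarrow> (eis4 has_field_derivative 2 * of_real pi * \<i> * Dz eis4 z) (at z)"
  and Dz_eis4: "Im z > 0 \<Longrightarrow> Dz eis4 z = eval_fps (fps_X * fps_deriv eis4_fps) (nome z)"
proof -
  assume "Im z > 0"
  then have D: "(eis4 has_field_derivative 2 * of_real pi * \<i> * eval_fps (fps_X * fps_deriv eis4_fps) (nome z)) (at z)"
    using conv_radius_eis4_fps eis4_eq_eval_fps by (rule eval_fps_nome_has_field_derivative)
  show eq: "Dz eis4 z = eval_fps (fps_X * fps_deriv eis4_fps) (nome z)"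
    unfolding Dz_def DERIV_imp_deriv[OF D] by simp
  show "(eis4 has_field_derivative 2 * of_real pi * \<i> * Dz eis4 z) (at z)"
    unfolding eq by (rule D)
qed

lemma eis6_has_field_derivative:
  "Im z > 0 \<Longrightarrow> (eis6 has_field_derivative 2 * of_real pi * \<i> * Dz eis6 z) (at z)"
  and Dz_eis6: "Im z > 0 \<Longrightarrow> Dz eis6 z = eval_fps (fps_X * fps_deriv eis6_fps) (nome z)"
proof -
  assume "Im z > 0"
  then have D: "(eis6 has_field_derivative 2 * of_real pi * \<i> * eval_fps (fps_X * fps_deriv eis6_fps) (nome z)) (at z)"
    using conv_radius_eis6_fps eis6_eq_eval_fps by (rule eval_fps_nome_has_field_derivative)
  show eq: "Dz eis6 z = eval_fps (fps_X * fps_deriv eis6_fps) (nome z)"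
    unfolding Dz_def DERIV_imp_deriv[OF D] by simp
  show "(eis6 has_field_derivative 2 * of_real pi * \<i> * Dz eis6 z) (at z)"
    unfolding eq by (rule D)
qed

lemma rankin_cohen_eis4_eis6:
  assumes z: "Im z > 0"
  shows "4 * eis4 z * Dz eis6 z - 6 * eis6 z * Dz eis4 z = - 2 * (eis4 z ^ 3 - eis6 z ^ 2)"
proof -
  define q where "q = nome z"
  have r4: "ereal (norm q) < fps_conv_radius eis4_fps"
    unfolding q_def using norm_nome_less_1[OF z] conv_radius_eis4_fps by (rule less_le_trans)
  have r6: "ereal (norm q) < fps_conv_radius eis6_fps"
    unfolding q_def using norm_nome_less_1[OF z] conv_radius_eis6_fps by (rule less_le_trans)
  \<comment> \<open>Evaluation respects products and differences only inside the disc of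
    convergence, so membership in the disc is propagated through each operation.\<close>
  have mult: "ereal (norm q) < fps_conv_radius (F * G)"
    if "ereal (norm q) < fps_conv_radius F" "ereal (norm q) < fps_conv_radius G" for F G :: "complex fps"
    using that by (intro less_le_trans[OF _ fps_conv_radius_mult]) simp
  have diff: "ereal (norm q) < fps_conv_radius (F - G)"
    if "ereal (norm q) < fps_conv_radius F" "ereal (norm q) < fps_conv_radius G" for F G :: "complex fps"
    using that by (intro less_le_trans[OF _ fps_conv_radius_diff]) simp
  have pow: "ereal (norm q) < fps_conv_radius (F ^ n)"
    if "ereal (norm q) < fps_conv_radius F" for F :: "complex fps" and n
    using that fps_conv_radius_power by (rule less_le_trans)
  have der: "ereal (norm q) < fps_conv_radius (fps_deriv F)"
    if "ereal (norm q) < fps_conv_radius F" for F :: "complex fps"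
    using that fps_conv_radius_deriv by (rule less_le_trans)
  let ?D = "\<lambda>F. fps_X * fps_deriv F :: complex fps"
  have "4 * eis4 z * Dz eis6 z - 6 * eis6 z * Dz eis4 z =
     eval_fps (4 * eis4_fps * ?D eis6_fps - 6 * eis6_fps * ?D eis4_fps) q"
    unfolding eis4_eq_eval_fps[OF z] eis6_eq_eval_fps[OF z] Dz_eis4[OF z] Dz_eis6[OF z] q_def[symmetric]
    by (simp add: eval_fps_diff eval_fps_mult mult der r4 r6)
  also have "\<dots> = eval_fps (- 2 * (eis4_fps ^ 3 - eis6_fps ^ 2)) q"
    unfolding eis_fps_rankin_cohen ..
  also have "\<dots> = - 2 * (eis4 z ^ 3 - eis6 z ^ 2)"
    unfolding eis4_eq_eval_fps[OF z] eis6_eq_eval_fps[OF z] q_def[symmetric]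
    by (simp add: eval_fps_minus eval_fps_diff eval_fps_mult eval_fps_power mult diff pow r4 r6)
  finally show ?thesis .
qed

section \<open>Jacobian Poisson brackets\<close>

abbreviation ddx :: "qm \<Rightarrow> qm" where "ddx \<equiv> pderiv"
definition ddy :: "qm \<Rightarrow> qm" where "ddy = map_poly pderiv"
definition ddz :: "qm \<Rightarrow> qm" where "ddz = map_poly (map_poly pderiv)"

text \<open>Linearity over the constants is not demanded, and the complex numbers have nonzero
  derivations of their own; therefore \<open>derivation_eqI\<close> compares values on constants
  too.\<close>

locale derivation =
  fixes d :: "'a::idom \<Rightarrow> 'a"
  assumes add: "d (a + b) = d a + d b"
    and mult: "d (a * b) = a * d b + d a * b"
begin

lemma zero [simp]: "d 0 = 0"
  by (metis add add_cancel_right_right)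

lemma one [simp]: "d 1 = 0"
  by (metis mult mult_1 mult_1_right add_cancel_right_right)

lemma minus: "d (- a) = - d a"
  using add[of a "- a"] by (simp add: eq_neg_iff_add_eq_0 add.commute)

lemma diff: "d (a - b) = d a - d b"
  using add[of a "- b"] by (simp add: minus)

lemma sum: "d (sum f A) = (\<Sum>a\<in>A. d (f a))"
  by (induction A rule: infinite_finite_induct) (simp_all add: add)

lemma of_nat [simp]: "d (of_nat n) = 0"
  by (induction n) (simp_all add: add)

lemma numeral [simp]: "d (numeral n) = 0"
  using of_nat[of "numeral n"] by simp

lemma power: "d (a ^ n) = of_nat n * a ^ (n - 1) * d a"
proof (induction n)
  case (Suc n)
  then show ?case by (cases n) (simp_all add: mult algebra_simps)
qed simp

text \<open>Lifts \<open>pderiv\<close> of an inner variable through the nesting: once for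
  \<open>ddy\<close>, twice for \<open>ddz\<close>.\<close>

lemma derivation_map_poly: "derivation (map_poly d)"
proof
  fix p q :: "'a poly"
  show "map_poly d (p + q) = map_poly d p + map_poly d q"
    by (rule poly_eqI) (simp add: coeff_map_poly add)
  show "map_poly d (p * q) = p * map_poly d q + map_poly d p * q"
    by (rule poly_eqI) (simp add: coeff_map_poly coeff_mult sum mult sum.distrib)
qed

lemma map_poly_pCons: "map_poly d (pCons a p) = pCons (d a) (map_poly d p)"
  by (rule poly_eqI) (simp add: coeff_map_poly coeff_pCons split: nat.splits)

lemma pderiv_map_poly: "pderiv (map_poly d p) = map_poly d (pderiv p)"
  by (rule poly_eqI) (simp add: coeff_map_poly coeff_pderiv mult add)

end

lemma derivation_pderiv: "derivation (pderiv :: 'a::idom poly \<Rightarrow> 'a poly)"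
  by unfold_locales (simp_all add: pderiv_add pderiv_mult mult.commute)

interpretation ddx: derivation ddx
  by (rule derivation_pderiv)
interpretation ddy: derivation ddy
  unfolding ddy_def by (rule derivation.derivation_map_poly derivation_pderiv)+
interpretation ddz: derivation ddz
  unfolding ddz_def by (rule derivation.derivation_map_poly derivation_pderiv)+

lemma ddy_pCons: "ddy (pCons p f) = pCons (pderiv p) (ddy f)"
  unfolding ddy_def by (rule derivation.map_poly_pCons[OF derivation_pderiv])

lemma ddz_pCons: "ddz (pCons p f) = pCons (map_poly pderiv p) (ddz f)"
  unfolding ddz_def
  by (rule derivation.map_poly_pCons[OF derivation.derivation_map_poly[OF derivation_pderiv]])

lemma ddx_ddy: "ddx (ddy f) = ddy (ddx f)"
  unfolding ddy_def by (rule derivation.pderiv_map_poly derivation_pderiv)+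

lemma ddx_ddz: "ddx (ddz f) = ddz (ddx f)"
  unfolding ddz_def by (rule derivation.pderiv_map_poly derivation.derivation_map_poly derivation_pderiv)+

lemma ddy_ddz: "ddy (ddz f) = ddz (ddy f)"
proof (rule poly_eqI)
  fix n
  show "coeff (ddy (ddz f)) n = coeff (ddz (ddy f)) n"
    unfolding ddy_def ddz_def
    by (simp add: coeff_map_poly derivation.pderiv_map_poly derivation_pderiv)
qed

lemma dd_generators [simp]:
  "ddx E2 = 1" "ddy E2 = 0" "ddz E2 = 0"
  "ddx E4 = 0" "ddy E4 = 1" "ddz E4 = 0"
  "ddx E6 = 0" "ddy E6 = 0" "ddz E6 = 1"
  "ddx (cst c) = 0" "ddy (cst c) = 0" "ddz (cst c) = 0"
  by (simp_all add: E2_def E4_def E6_def cst_def ddy_pCons ddz_pCons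
      derivation.map_poly_pCons[OF derivation_pderiv] pderiv_pCons one_pCons
      derivation.zero[OF derivation_pderiv])

lemma eq_minus_self_imp_zero:
  fixes f :: qm
  assumes "f = - f"
  shows "f = 0"
proof -
  have "2 * f = 0" using assms by (simp only: eq_neg_iff_add_eq_0 mult_2)
  then show ?thesis by simp
qed

text \<open>The determinant with rows \<open>grad k\<close>, \<open>grad f\<close>,
  \<open>grad g\<close>. The potential stands first so that \<open>jac k\<close> is a bracket; the
  cyclic move from \<open>jac(f, g, k)\<close> preserves the sign.\<close>

definition jac :: "qm \<Rightarrow> qm \<Rightarrow> qm \<Rightarrow> qm" where
  "jac k f g = ddx k * (ddy f * ddz g - ddz f * ddy g) + ddy k * (ddz f * ddx g - ddx f * ddz g)
     + ddz k * (ddx f * ddy g - ddy f * ddx g)"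

text \<open>Horner's scheme peels off one variable at a time, so later arguments see generators
  instead of nested lists.\<close>

lemma modular_form_induct [consumes 1, case_names const E4 E6 add mult]:
  assumes "f \<in> modular_forms" and const: "\<And>c. P (cst c)" and "P E4" "P E6"
    and add: "\<And>f g. P f \<Longrightarrow> P g \<Longrightarrow> P (f + g)" and mult: "\<And>f g. P f \<Longrightarrow> P g \<Longrightarrow> P (f * g)"
  shows "P f"
proof -
  have 0: "P 0" using const[of 0] by (simp add: cst_def)
  have z: "P [:[:r:]:]" for r
  proof (induction r)
    case (pCons a r)
    have "[:[:pCons a r:]:] = cst a + E6 * [:[:r:]:]" by (simp add: cst_def E6_def)
    then show ?case using pCons const \<open>P E6\<close> add mult by metis
  qed (simp add: 0)
  have y: "P [:p:]" for p
  proof (induction p)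
    case (pCons r p)
    have "[:pCons r p:] = [:[:r:]:] + E4 * [:p:]" by (simp add: E4_def)
    then show ?case using pCons z \<open>P E4\<close> add mult by metis
  qed (simp add: 0)
  show ?thesis using assms(1) y by (auto simp: modular_forms_def)
qed

lemma qm_induct [case_names const E2 E4 E6 add mult]:
  assumes const: "\<And>c. P (cst c)" and "P E2" and gens: "P E4" "P E6"
    and add: "\<And>f g. P f \<Longrightarrow> P g \<Longrightarrow> P (f + g)" and mult: "\<And>f g. P f \<Longrightarrow> P g \<Longrightarrow> P (f * g)"
  shows "P f"
proof (induction f)
  case 0
  show ?case using const[of 0] by (simp add: cst_def)
next
  case (pCons p f)
  have "[:p:] \<in> modular_forms" by (simp add: modular_forms_def)
  then have "P [:p:]" by (rule modular_form_induct) (fact const gens add mult)+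
  moreover have "pCons p f = [:p:] + E2 * f" by (simp add: E2_def)
  ultimately show ?case using pCons \<open>P E2\<close> add mult by metis
qed

lemma derivation_eqI:
  assumes "derivation d" "derivation d'"
    and "\<And>c. d (cst c) = d' (cst c)" "d E2 = d' E2" "d E4 = d' E4" "d E6 = d' E6"
  shows "d f = d' f"
  by (induction f rule: qm_induct)
     (use assms in \<open>simp_all add: derivation.add derivation.mult\<close>)

text \<open>The Jacobiator is alternating and a derivation in each argument, so it vanishes once it
  does so on the one triple of distinct generators.\<close>

lemma jacobi_identity_generators:
  fixes b :: "qm \<Rightarrow> qm \<Rightarrow> qm"
  assumes der: "\<And>f. derivation (b f)" and cst: "\<And>f c. b f (cst c) = 0"
    and skew: "\<And>f g. b f g = - b g f"
    and gen: "b E2 (b E4 E6) + b E4 (b E6 E2) + b E6 (b E2 E4) = 0"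
  shows "b f (b g h) + b g (b h f) + b h (b f g) = 0"
proof -
  define J where "J f g h = b f (b g h) + b g (b h f) + b h (b f g)" for f g h
  have cst': "b (cst c) g = 0" for c g using skew[of "cst c" g] cst by simp
  have [simp]: "b f 0 = 0" for f using der by (rule derivation.zero)
  note b_minus = derivation.minus[OF der] and b_add = derivation.add[OF der]
    and b_mult = derivation.mult[OF der]
  have b_add': "b (f + f') g = b f g + b f' g" for f f' g
    using skew[of "f + f'" g] skew[of f g] skew[of f' g] by (simp add: b_add)
  have b_mult': "b (f * f') g = f * b f' g + b f g * f'" for f f' g
    using skew[of "f * f'" g] skew[of f g] skew[of f' g] by (simp add: b_mult)
  have derJ: "derivation (\<lambda>f. J f g h)" for g h
  proof
    fix p q
    show "J (p + q) g h = J p g h + J q g h"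
      by (simp add: J_def b_add b_add' algebra_simps)
    \<comment> \<open>The cross terms of the Leibniz rule pair up into sums that vanish by
      skew-symmetry.\<close>
    have "J (p * q) g h = p * J q g h + J p g h * q
        + (b g p + b p g) * b h q + (b h p * (b g q + b q g))"
      by (simp add: J_def b_add b_mult b_mult' algebra_simps)
    then show "J (p * q) g h = p * J q g h + J p g h * q"
      using skew[of p g] skew[of q g] by simp
  qed
  have der0: "derivation (\<lambda>_ :: qm. 0 :: qm)"
    by unfold_locales simp_all
  have J_cst: "J (cst c) g h = 0" for c g h
    by (simp add: J_def cst cst')
  have cyc: "J f g h = J g h f" for f g h
    by (simp add: J_def)
  have swap: "J f g h = - J g f h" for f g h
  proof -
    have "b f (b g h) = - b f (b h g)" for f g h
      by (subst skew[of g h]) (rule b_minus)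
    from this[of f g h] this[of g h f] this[of h f g] show ?thesis
      by (simp add: J_def)
  qed
  have J_self: "J f f h = 0" for f h
    by (rule eq_minus_self_imp_zero) (rule swap)
  have J_self': "J f h f = 0" "J h f f = 0" for f h
    using J_self[of f h] cyc[of h f f] cyc[of f h f] by simp_all
  have J0: "J E2 E4 E6 = 0" unfolding J_def by (rule gen)
  have "J E4 E6 E2 = 0" "J E6 E2 E4 = 0"
    using J0 cyc[of E2 E4 E6] cyc[of E4 E6 E2] by simp_all
  then have J_gens: "J E2 E4 E6 = 0" "J E4 E6 E2 = 0" "J E6 E2 E4 = 0"
      "J E4 E2 E6 = 0" "J E6 E4 E2 = 0" "J E2 E6 E4 = 0"
    using J0 swap[of E2 E4 E6] swap[of E4 E6 E2] swap[of E6 E2 E4] by simp_all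
  let ?gens = "{E2, E4, E6}"
  \<comment> \<open>The arguments are freed from the generators one by one; cyclic symmetry brings
    the next one to the front, where \<open>derJ\<close> applies.\<close>
  have J1: "J f g h = 0" if "g \<in> ?gens" "h \<in> ?gens" for f g h
    by (rule derivation_eqI[OF derJ der0]) (use that in \<open>auto simp: J_cst J_self J_self' J_gens\<close>)
  have J2: "J f h g = 0" if g: "g \<in> ?gens" for f g h
  proof -
    have J_gen: "J e h g = 0" if "e \<in> ?gens" for e
      using cyc[of e h g] J1[of g e h] \<open>e \<in> ?gens\<close> g by metis
    show ?thesis
      by (rule derivation_eqI[OF derJ der0]) (simp_all add: J_cst J_gen)
  qed
  have J_gen: "J e g h = 0" if "e \<in> ?gens" for e
    using cyc[of e g h] J2[of e g h] \<open>e \<in> ?gens\<close> by metis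
  have "J f g h = 0"
    by (rule derivation_eqI[OF derJ der0]) (simp_all add: J_cst J_gen)
  then show ?thesis by (simp only: J_def)
qed

lemma derivation_jac: "derivation (jac k f)"
  by unfold_locales
    (simp_all add: jac_def ddx.add ddx.mult ddy.add ddy.mult ddz.add ddz.mult algebra_simps)

lemma jac_skew: "jac k f g = - jac k g f"
  by (simp add: jac_def algebra_simps)

text \<open>On the generators, the Jacobi identity says that the divergence of the curl of \<open>grad k\<close> vanishes.\<close>

lemma poisson_bracket_jac: "poisson_bracket (jac k)"
proof -
  have der: "jac k f (g + h) = jac k f g + jac k f h" "jac k f (g * h) = g * jac k f h + jac k f g * h"
    for f g h by (rule derivation.add[OF derivation_jac] derivation.mult[OF derivation_jac])+
  have cst: "jac k f (cst c) = 0" for f c by (simp add: jac_def)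
  have der': "jac k (f + g) h = jac k f h + jac k g h" "jac k (f * g) h = f * jac k g h + jac k f h * g"
    for f g h by (simp_all add: jac_skew[of k _ h] der)
  have cst': "jac k (cst c * f) g = cst c * jac k f g" "jac k f (cst c * g) = cst c * jac k f g" for f g c
    by (simp_all add: der der' cst jac_skew[of k "cst c"])
  have "jac k E2 (jac k E4 E6) + jac k E4 (jac k E6 E2) + jac k E6 (jac k E2 E4) = 0"
    by (simp add: jac_def ddx_ddy ddx_ddz ddy_ddz algebra_simps)
  then have jacobi: "jac k f (jac k g h) + jac k g (jac k h f) + jac k h (jac k f g) = 0" for f g h
    by (rule jacobi_identity_generators[OF derivation_jac cst jac_skew])
  show ?thesis unfolding poisson_bracket_def
    by (intro conjI allI) (rule der der' cst' jac_skew jacobi)+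
qed

lemma poisson_bracket_derivation:
  assumes "poisson_bracket b"
  shows "derivation (b f)" and "derivation (\<lambda>f. b f g)"
  using assms unfolding poisson_bracket_def by (unfold_locales; metis)+

lemma poisson_bracket_cst:
  assumes "poisson_bracket b"
  shows "b f (cst c) = 0" and "b (cst c) g = 0"
proof -
  have eq: "cst c = cst c * 1" by simp
  have "b f (cst c * 1) = cst c * b f 1" "b (cst c * 1) g = cst c * b 1 g"
    using assms unfolding poisson_bracket_def by metis+
  then show "b f (cst c) = 0" "b (cst c) g = 0"
    using derivation.one[OF poisson_bracket_derivation(1)[OF assms]]
      derivation.one[OF poisson_bracket_derivation(2)[OF assms]] by simp_all
qed

text \<open>A biderivation killing constants is fixed by its values on generators. This justifies
  saying that the bracket is defined by these values.\<close>

lemma poisson_bracket_eqI: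
  assumes b: "poisson_bracket b" and b': "poisson_bracket b'"
    and gen: "b E2 E4 = b' E2 E4" "b E2 E6 = b' E2 E6" "b E4 E6 = b' E4 E6"
  shows "b = b'"
proof -
  have skew: "b f g = - b g f" "b' f g = - b' g f" for f g
    using b b' unfolding poisson_bracket_def by metis+
  have self: "b f f = 0" "b' f f = 0" for f
    by (rule eq_minus_self_imp_zero, rule skew)+
  have gen': "b E4 E2 = b' E4 E2" "b E6 E2 = b' E6 E2" "b E6 E4 = b' E6 E4"
    using skew[of E4 E2] skew[of E6 E2] skew[of E6 E4] gen by simp_all
  have first: "b f g = b' f g" if f: "f \<in> {E2, E4, E6}" for f g
    using poisson_bracket_derivation(1)[OF b] poisson_bracket_derivation(1)[OF b']
    by (rule derivation_eqI) (use f in \<open>auto simp: poisson_bracket_cst b b' gen gen' self\<close>)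
  have "b f g = b' f g" for f g
    by (rule derivation_eqI[OF poisson_bracket_derivation(2)[OF b] poisson_bracket_derivation(2)[OF b']])
      (simp_all add: poisson_bracket_cst b b' first)
  then show ?thesis by blast
qed

lemma dd_potential:
  "ddx (potential \<mu>) = - 2 * Delta"
  "ddy (potential \<mu>) = - 6 * E4 ^ 2 * E2 + 2 * cst \<mu> * E4 * E6"
  "ddz (potential \<mu>) = 4 * E6 * E2 + cst \<mu> * E4 ^ 2"
  unfolding potential_def Delta_def
  by (simp_all add: ddx.add ddx.diff ddx.mult ddx.power ddy.add ddy.diff ddy.mult ddy.power
      ddz.add ddz.diff ddz.mult ddz.power ddx.minus ddy.minus ddz.minus algebra_simps)

lemma bracket_values_jac: "bracket_values \<mu> (jac (potential \<mu>))"
  by (simp add: bracket_values_def jac_def dd_potential algebra_simps)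

lemma jacobian_with_potential_jac: "jacobian_with_potential (jac k) k"
  by (simp add: jacobian_with_potential_def grad_def jac_def flip: ddy_def ddz_def)

section \<open>Scaling automorphisms, weight and depth\<close>

text \<open>\<open>E2\<close> is the outermost variable, so composition rescales it and leaves
  \<open>E4\<close> and \<open>E6\<close> alone.\<close>

definition scale :: "complex \<Rightarrow> qm \<Rightarrow> qm" where
  "scale c f = pcompose f (cst c * E2)"

lemma cst_1 [simp]: "cst 1 = 1"
  by (simp add: cst_def one_pCons)

lemma scale_hom:
  "scale c (f + g) = scale c f + scale c g"
  "scale c (f - g) = scale c f - scale c g"
  "scale c (f * g) = scale c f * scale c g"
  by (simp_all add: scale_def pcompose_add pcompose_diff pcompose_mult)

lemma scale_modular_form: "f \<in> modular_forms \<Longrightarrow> scale c f = f"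
  by (auto simp: modular_forms_def scale_def)

lemma scale_const [simp]: "scale c (cst a) = cst a"
  by (simp add: scale_def cst_def)

lemma scale_0 [simp]: "scale c 0 = 0" and scale_1 [simp]: "scale c 1 = 1"
  using scale_const[of c 0] scale_const[of c 1] by (simp_all add: cst_def one_pCons)

lemma scale_generators [simp]: "scale c E2 = cst c * E2" "scale c E4 = E4" "scale c E6 = E6"
  by (simp_all add: scale_def E2_def E4_def E6_def pcompose_pCons)

lemma cst_mult: "cst (a * b) = cst a * cst b"
  by (simp add: cst_def)

lemma numeral_eq_cst: "numeral n = cst (numeral n)"
  by (simp add: cst_def numeral_poly)

lemma cst_eq_0_iff [simp]: "cst a = 0 \<longleftrightarrow> a = 0"
  by (simp add: cst_def)

lemma scale_scale: "scale a (scale b f) = scale (b * a) f"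
  by (induction f rule: qm_induct) (simp_all add: scale_hom cst_mult)

lemma scale_by_1: "scale 1 f = f"
  by (induction f rule: qm_induct) (simp_all add: scale_hom)

lemma dd_scale:
  "ddx (scale c f) = cst c * scale c (ddx f)"
  "ddy (scale c f) = scale c (ddy f)"
  "ddz (scale c f) = scale c (ddz f)"
  by (induction f rule: qm_induct)
    (simp_all add: scale_hom ddx.add ddy.add ddz.add ddx.mult ddy.mult ddz.mult algebra_simps)

lemma algebra_iso_scale:
  assumes "c \<noteq> 0"
  shows "algebra_iso (scale c)"
proof -
  have "bij (scale c)"
    by (rule bij_betw_byWitness[where f' = "scale (1 / c)"]) (use assms in \<open>auto simp: scale_scale scale_by_1\<close>)
  then show ?thesis
    by (simp add: algebra_iso_def scale_hom)
qed

text \<open>The chain rule; \<open>cst c\<close> is the Jacobian determinant of the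
  substitution.\<close>

lemma jac_scale: "cst c * scale c (jac k f g) = jac (scale c k) (scale c f) (scale c g)"
  by (simp add: jac_def dd_scale scale_hom algebra_simps)

lemma poisson_modular_isomorphic_jac:
  assumes "\<mu> \<noteq> 0" "\<mu>' \<noteq> 0"
  shows "poisson_modular_isomorphic (jac (potential \<mu>)) (jac (potential \<mu>'))"
proof -
  \<comment> \<open>This ratio makes \<open>scale c\<close> send the first potential to
    \<open>cst c\<close> times the second. That factor then cancels the one in
    \<open>jac_scale\<close>.\<close>
  define c where "c = \<mu> / \<mu>'"
  have c: "c \<noteq> 0" "\<mu> = c * \<mu>'" using assms by (simp_all add: c_def)
  have "Delta \<in> modular_forms"
    by (simp add: modular_forms_def Delta_def E4_def E6_def power_numeral_reduce)
  then have "scale c Delta = Delta" by (rule scale_modular_form)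
  moreover have pot: "potential \<nu> = cst (- 2) * Delta * E2 + cst \<nu> * E4 * E4 * E6" for \<nu>
    by (simp add: potential_def cst_def numeral_poly power2_eq_square)
  ultimately have "scale c (potential \<mu>) = cst c * potential \<mu>'"
    unfolding pot c(2) cst_mult by (simp add: scale_hom algebra_simps)
  then have "cst c * scale c (jac (potential \<mu>) f g) =
      cst c * jac (potential \<mu>') (scale c f) (scale c g)" for f g
    unfolding jac_scale by (simp add: jac_def ddx.mult ddy.mult ddz.mult algebra_simps)
  then have "scale c (jac (potential \<mu>) f g) = jac (potential \<mu>') (scale c f) (scale c g)" for f g
    using c(1) by simp
  moreover have "scale c ` modular_forms \<subseteq> modular_forms"
    by (auto simp: scale_modular_form)
  ultimately show ?thesis
    unfolding poisson_modular_isomorphic_def using algebra_iso_scale[OF c(1)] by blast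
qed

text \<open>
  The depth bound \<open>s\<close> is an integer, since differentiating by \<open>E2\<close> lowers it to \<open>s - 1\<close> and \<open>-1\<close> forces \<open>f = 0\<close>.
\<close>

definition homogeneous :: "int \<Rightarrow> int \<Rightarrow> qm \<Rightarrow> bool" where
  "homogeneous k s f \<longleftrightarrow> (\<forall>i j l. coeff (coeff (coeff f i) j) l \<noteq> 0 \<longrightarrow>
     2 * int i + 4 * int j + 6 * int l = k \<and> int i \<le> s)"

lemma homogeneous_mono: "homogeneous k s f \<Longrightarrow> k = k' \<Longrightarrow> s \<le> s' \<Longrightarrow> homogeneous k' s' f"
  by (force simp: homogeneous_def)

lemma homogeneous_0 [simp]: "homogeneous k s 0"
  by (simp add: homogeneous_def)

lemma homogeneous_add: "homogeneous k s f \<Longrightarrow> homogeneous k s g \<Longrightarrow> homogeneous k s (f + g)"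
  unfolding homogeneous_def coeff_add by (metis add_0)

lemma homogeneous_minus: "homogeneous k s f \<Longrightarrow> homogeneous k s (- f)"
  by (simp add: homogeneous_def)

lemma homogeneous_diff: "homogeneous k s f \<Longrightarrow> homogeneous k s g \<Longrightarrow> homogeneous k s (f - g)"
  using homogeneous_add[of k s f "- g"] homogeneous_minus[of k s g] by simp

lemma homogeneous_sum: "(\<And>a. a \<in> A \<Longrightarrow> homogeneous k s (f a)) \<Longrightarrow> homogeneous k s (sum f A)"
  by (induction A rule: infinite_finite_induct) (simp_all add: homogeneous_add)

lemma homogeneous_mult:
  assumes f: "homogeneous k s f" and g: "homogeneous l t g"
  shows "homogeneous (k + l) (s + t) (f * g)"
  unfolding homogeneous_def
proof (intro allI impI)
  fix i j m assume "coeff (coeff (coeff (f * g) i) j) m \<noteq> 0"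
  then have "(\<Sum>i'\<le>i. \<Sum>j'\<le>j. \<Sum>m'\<le>m. coeff (coeff (coeff f i') j') m' *
      coeff (coeff (coeff g (i - i')) (j - j')) (m - m')) \<noteq> 0"
    by (simp add: coeff_mult coeff_sum)
  then obtain i' j' m' where le: "i' \<le> i" "j' \<le> j" "m' \<le> m"
    and "coeff (coeff (coeff f i') j') m' \<noteq> 0"
    and "coeff (coeff (coeff g (i - i')) (j - j')) (m - m') \<noteq> 0"
    by (auto elim!: sum.not_neutral_contains_not_neutral)
  then show "2 * int i + 4 * int j + 6 * int m = k + l \<and> int i \<le> s + t"
    using f[unfolded homogeneous_def, rule_format, of i' j' m']
      g[unfolded homogeneous_def, rule_format, of "i - i'" "j - j'" "m - m'"]
    by (auto simp: of_nat_diff)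
qed

lemma homogeneous_generators:
  "homogeneous 2 1 E2" "homogeneous 4 0 E4" "homogeneous 6 0 E6" "homogeneous 0 0 (cst c)"
  by (auto simp: homogeneous_def E2_def E4_def E6_def cst_def coeff_pCons one_pCons split: nat.splits)

lemma homogeneous_numeral: "homogeneous 0 0 (numeral n)"
  by (metis numeral_eq_cst homogeneous_generators(4))

lemma homogeneous_power: "homogeneous k s f \<Longrightarrow> homogeneous (int n * k) (int n * s) (f ^ n)"
proof (induction n)
  case 0
  show ?case using homogeneous_generators(4)[of 1] by simp
next
  case (Suc n)
  show ?case using homogeneous_mult[OF Suc.prems Suc.IH[OF Suc.prems]] by (simp add: algebra_simps)
qed

lemma coeff_of_nat_mult: "coeff (of_nat n * p) i = of_nat n * coeff p i"
  by (simp add: of_nat_poly)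

lemma coeff_dd:
  "coeff (coeff (coeff (ddx f) i) j) l = of_nat (Suc i) * coeff (coeff (coeff f (Suc i)) j) l"
  "coeff (coeff (coeff (ddy f) i) j) l = of_nat (Suc j) * coeff (coeff (coeff f i) (Suc j)) l"
  "coeff (coeff (coeff (ddz f) i) j) l = of_nat (Suc l) * coeff (coeff (coeff f i) j) (Suc l)"
  by (simp_all only: ddy_def ddz_def coeff_map_poly coeff_pderiv coeff_of_nat_mult pderiv_0 map_poly_0)

lemma homogeneous_dd:
  assumes "homogeneous k s f"
  shows "homogeneous (k - 2) (s - 1) (ddx f)"
    and "homogeneous (k - 4) s (ddy f)"
    and "homogeneous (k - 6) s (ddz f)"
  unfolding homogeneous_def coeff_dd
  using assms[unfolded homogeneous_def] by fastforce+

text \<open>Every monomial is an eigenvector of the operator on the right, with its weight as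
  eigenvalue.\<close>

lemma euler_identity:
  assumes "homogeneous k s f"
  shows "cst (of_int k) * f = 2 * E2 * ddx f + 4 * E4 * ddy f + 6 * E6 * ddz f"
proof -
  have coeff_cst: "coeff (coeff (coeff (cst c * f) i) j) l = c * coeff (coeff (coeff f i) j) l" for c f i j l
    by (simp add: cst_def)
  \<comment> \<open>Multiplying by a variable undoes the index shift of differentiation. At exponent
    0 the truncated \<open>i - 1\<close> is harmless, as both sides are 0.\<close>
  have coeff_gen:
    "coeff (coeff (coeff (E2 * ddx f) i) j) l = of_nat i * coeff (coeff (coeff f i) j) l"
    "coeff (coeff (coeff (E4 * ddy f) i) j) l = of_nat j * coeff (coeff (coeff f i) j) l"
    "coeff (coeff (coeff (E6 * ddz f) i) j) l = of_nat l * coeff (coeff (coeff f i) j) l" for i j l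
    using coeff_dd(1)[of f "i - 1" j l] coeff_dd(2)[of f i "j - 1" l] coeff_dd(3)[of f i j "l - 1"]
    by (auto simp: E2_def E4_def E6_def coeff_pCons split: nat.splits)
  show ?thesis
  proof (intro poly_eqI)
    fix i j l
    have "of_int k * coeff (coeff (coeff f i) j) l =
        (2 * of_nat i + 4 * of_nat j + 6 * of_nat l) * coeff (coeff (coeff f i) j) l"
    proof (cases "coeff (coeff (coeff f i) j) l = 0")
      case False
      then have "k = 2 * int i + 4 * int j + 6 * int l"
        using assms unfolding homogeneous_def by metis
      then show ?thesis by simp
    qed simp
    then show "coeff (coeff (coeff (cst (of_int k) * f) i) j) l =
        coeff (coeff (coeff (2 * E2 * ddx f + 4 * E4 * ddy f + 6 * E6 * ddz f) i) j) l"
      unfolding numeral_eq_cst mult.assoc coeff_add coeff_cst coeff_gen by (simp add: algebra_simps)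
  qed
qed

lemma modular_weight_iff: "f \<in> modular_weight k \<longleftrightarrow> homogeneous k 0 f"
proof
  assume "f \<in> modular_weight k"
  then show "homogeneous k 0 f"
    by (auto simp: modular_weight_def modular_forms_def homogeneous_def coeff_pCons split: nat.splits)
next
  assume h: "homogeneous k 0 f"
  have "coeff f (Suc i) = 0" for i
    using h by (intro poly_eqI) (force simp: homogeneous_def)
  then have "f = [:coeff f 0:]"
    by (intro poly_eqI) (simp add: coeff_pCons split: nat.splits)
  then have "f \<in> modular_forms" unfolding modular_forms_def by (rule range_eqI)
  then show "f \<in> modular_weight k"
    using h[unfolded homogeneous_def, rule_format, of 0] by (simp add: modular_weight_def)
qed

text \<open>The expansion in powers of \<open>E2\<close> is the list of outer coefficients, which
  supplies the witness for \<open>F\<close>.\<close>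

lemma quasimodular_iff: "f \<in> quasimodular k s \<longleftrightarrow> homogeneous k (int s) f"
proof
  assume "f \<in> quasimodular k s"
  then obtain F where f: "f = (\<Sum>j\<le>s. F j * E2 ^ j)" and F: "\<And>j. j \<le> s \<Longrightarrow> F j \<in> modular_weight (k - 2 * int j)"
    by (auto simp: quasimodular_def)
  show "homogeneous k (int s) f"
    unfolding f
  proof (rule homogeneous_sum)
    fix j assume "j \<in> {..s}"
    then have j: "j \<le> s" by simp
    show "homogeneous k (int s) (F j * E2 ^ j)"
      using homogeneous_mult[OF F[OF j, unfolded modular_weight_iff]
          homogeneous_power[OF homogeneous_generators(1), of j]]
      by (rule homogeneous_mono) (use j in auto)
  qed
next
  assume h: "homogeneous k (int s) f"
  have "degree f \<le> s"
  proof (rule degree_le, intro allI impI)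
    fix i assume "i > s"
    then show "coeff f i = 0"
      using h by (intro poly_eqI) (force simp: homogeneous_def)
  qed
  then have "f = (\<Sum>j\<le>s. monom (coeff f j) j)"
    by (rule poly_as_sum_of_monoms'[symmetric])
  also have "\<dots> = (\<Sum>j\<le>s. [:coeff f j:] * E2 ^ j)"
    by (simp add: E2_def monom_altdef)
  finally have sum: "f = (\<Sum>j\<le>s. [:coeff f j:] * E2 ^ j)" .
  have weight: "[:coeff f j:] \<in> modular_weight (k - 2 * int j)" for j
    using h by (force simp: modular_weight_def modular_forms_def homogeneous_def)
  show "f \<in> quasimodular k s"
    unfolding quasimodular_def mem_Collect_eq
    by (intro exI[of _ "\<lambda>j. [:coeff f j:]"] conjI allI impI weight sum)
qed

lemma homogeneous_dd_potential:
  "homogeneous 12 0 (ddx (potential \<mu>))"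
  "homogeneous 10 1 (ddy (potential \<mu>))"
  "homogeneous 8 1 (ddz (potential \<mu>))"
proof -
  have "homogeneous 12 0 (E4 ^ 3)" "homogeneous 12 0 (E6 ^ 2)" "homogeneous 8 0 (E4 ^ 2)"
    using homogeneous_power[of 4 0 E4 3] homogeneous_power[of 6 0 E6 2] homogeneous_power[of 4 0 E4 2]
    by (simp_all add: homogeneous_generators)
  then have "homogeneous 12 0 (- 2 * Delta)" "homogeneous 8 0 (cst \<mu> * E4 ^ 2)"
    using homogeneous_mult[OF homogeneous_minus[OF homogeneous_numeral[of "num.Bit0 num.One"]], of 12 0 Delta]
      homogeneous_mult[OF homogeneous_generators(4), of 8 0 "E4 ^ 2" \<mu>]
    by (simp_all add: Delta_def homogeneous_diff)
  then have "homogeneous 14 1 (- 2 * Delta * E2)" "homogeneous 14 1 (cst \<mu> * E4 ^ 2 * E6)"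
    using homogeneous_mult[OF _ homogeneous_generators(1), of 12 0 "- 2 * Delta"]
      homogeneous_mult[OF _ homogeneous_generators(3), of 8 0 "cst \<mu> * E4 ^ 2"]
    by (auto intro: homogeneous_mono)
  then have "homogeneous 14 1 (potential \<mu>)"
    unfolding potential_def by (rule homogeneous_add)
  from homogeneous_dd[OF this] show "homogeneous 12 0 (ddx (potential \<mu>))"
    "homogeneous 10 1 (ddy (potential \<mu>))" "homogeneous 8 1 (ddz (potential \<mu>))"
    by simp_all
qed

text \<open>The potential has weight 14 and depth at most 1. Every term of the determinant
  differentiates once in each variable, which lowers the weight by 2 + 4 + 6 = 12 and the depth by
  1.\<close>

lemma homogeneous_jac_potential:
  assumes f: "homogeneous k s f" and g: "homogeneous l t g"
  shows "homogeneous (k + l + 2) (s + t) (jac (potential \<mu>) f g)"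
proof -
  note F = homogeneous_dd[OF f] and G = homogeneous_dd[OF g] and K = homogeneous_dd_potential[of \<mu>]
  have "homogeneous (k + l + 2) (s + t) (ddx (potential \<mu>) * (ddy f * ddz g - ddz f * ddy g))"
    by (rule homogeneous_mono[OF homogeneous_mult[OF K(1) homogeneous_diff[OF
        homogeneous_mult[OF F(2) G(3)] homogeneous_mono[OF homogeneous_mult[OF F(3) G(2)]]]]]) simp_all
  moreover have "homogeneous (k + l + 2) (s + t) (ddy (potential \<mu>) * (ddz f * ddx g - ddx f * ddz g))"
    by (rule homogeneous_mono[OF homogeneous_mult[OF K(2) homogeneous_diff[OF
        homogeneous_mult[OF F(3) G(1)] homogeneous_mono[OF homogeneous_mult[OF F(1) G(3)]]]]]) simp_all
  moreover have "homogeneous (k + l + 2) (s + t) (ddz (potential \<mu>) * (ddx f * ddy g - ddy f * ddx g))"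
    by (rule homogeneous_mono[OF homogeneous_mult[OF K(3) homogeneous_diff[OF
        homogeneous_mult[OF F(1) G(2)] homogeneous_mono[OF homogeneous_mult[OF F(2) G(1)]]]]]) simp_all
  ultimately show ?thesis
    unfolding jac_def by (intro homogeneous_add)
qed

section \<open>The bracket on modular forms\<close>

lemma qm_fun_hom [simp]:
  "qm_fun (f + g) z = qm_fun f z + qm_fun g z"
  "qm_fun (f - g) z = qm_fun f z - qm_fun g z"
  "qm_fun (f * g) z = qm_fun f z * qm_fun g z"
  "qm_fun (- f) z = - qm_fun f z"
  "qm_fun (f ^ n) z = qm_fun f z ^ n"
  by (simp_all add: qm_fun_def poly_power)

lemma qm_fun_simps [simp]:
  "qm_fun (cst c) z = c" "qm_fun E4 z = eis4 z" "qm_fun E6 z = eis6 z"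
  "qm_fun 0 z = 0" "qm_fun 1 z = 1" "qm_fun (numeral n) z = numeral n"
  by (simp_all add: qm_fun_def cst_def E4_def E6_def)

text \<open>Both sides obey the sum and product rules in \<open>f\<close>, so the chain rule need
  only be checked on constants, \<open>E4\<close> and \<open>E6\<close>.\<close>

lemma Dz_qm_fun:
  assumes f: "f \<in> modular_forms" and z: "Im z > 0"
  shows "Dz (qm_fun f) z = qm_fun (ddy f) z * Dz eis4 z + qm_fun (ddz f) z * Dz eis6 z"
proof -
  have "(qm_fun f has_field_derivative
      2 * of_real pi * \<i> * (qm_fun (ddy f) z * Dz eis4 z + qm_fun (ddz f) z * Dz eis6 z)) (at z)"
    using f
  proof (induction f rule: modular_form_induct)
    case (const c)
    have "qm_fun (cst c) = (\<lambda>_. c)" by (rule ext) simp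
    then show ?case by simp
  next
    case E4
    have "qm_fun E4 = eis4" by (rule ext) simp
    then show ?case using eis4_has_field_derivative[OF z] by simp
  next
    case E6
    have "qm_fun E6 = eis6" by (rule ext) simp
    then show ?case using eis6_has_field_derivative[OF z] by simp
  next
    case (add f g)
    have "qm_fun (f + g) = (\<lambda>z. qm_fun f z + qm_fun g z)" by (rule ext) simp
    then show ?case using DERIV_add[OF add] by (simp add: ddy.add ddz.add algebra_simps)
  next
    case (mult f g)
    have "qm_fun (f * g) = (\<lambda>z. qm_fun f z * qm_fun g z)" by (rule ext) simp
    then show ?case using DERIV_mult[OF mult] by (simp add: ddy.mult ddz.mult algebra_simps)
  qed
  from DERIV_imp_deriv[OF this] show ?thesis
    by (simp add: Dz_def)
qed

lemma ddx_modular_form: "f \<in> modular_forms \<Longrightarrow> ddx f = 0"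
  by (auto simp: modular_forms_def pderiv_pCons)

lemma qm_fun_jac_eq_RC1:
  assumes f: "f \<in> modular_weight k" and g: "g \<in> modular_weight l" and z: "Im z > 0"
  shows "qm_fun (jac (potential \<mu>) f g) z = RC1 k l (qm_fun f) (qm_fun g) z"
proof -
  have fg: "f \<in> modular_forms" "g \<in> modular_forms"
    using f g by (auto simp: modular_weight_def)
  have euler: "of_int k * qm_fun f z = 4 * eis4 z * qm_fun (ddy f) z + 6 * eis6 z * qm_fun (ddz f) z"
    if "f \<in> modular_weight k" for f k
  proof -
    have "f \<in> modular_forms" using that by (simp add: modular_weight_def)
    then have "cst (of_int k) * f = 4 * E4 * ddy f + 6 * E6 * ddz f"
      using euler_identity[OF that[unfolded modular_weight_iff]] by (simp add: ddx_modular_form)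
    from arg_cong[OF this, of "\<lambda>h. qm_fun h z"] show ?thesis by simp
  qed
  define a b c d where "a = qm_fun (ddy f) z" "b = qm_fun (ddz f) z"
    "c = qm_fun (ddy g) z" "d = qm_fun (ddz g) z"
  note abcd = a_b_c_d_def
  have "RC1 k l (qm_fun f) (qm_fun g) z =
      (of_int k * qm_fun f z) * Dz (qm_fun g) z - (of_int l * qm_fun g z) * Dz (qm_fun f) z"
    by (simp add: RC1_def)
  also have "\<dots> = (4 * eis4 z * a + 6 * eis6 z * b) * (c * Dz eis4 z + d * Dz eis6 z)
      - (4 * eis4 z * c + 6 * eis6 z * d) * (a * Dz eis4 z + b * Dz eis6 z)"
    unfolding euler[OF f] euler[OF g] Dz_qm_fun[OF fg(1) z] Dz_qm_fun[OF fg(2) z] abcd ..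
  \<comment> \<open>The terms in \<open>a * c\<close> and \<open>b * d\<close> cancel, leaving the
    bracket of the two generators times a 2 by 2 determinant.\<close>
  also have "\<dots> = (4 * eis4 z * Dz eis6 z - 6 * eis6 z * Dz eis4 z) * (a * d - b * c)"
    by (simp add: algebra_simps)
  also have "\<dots> = qm_fun (jac (potential \<mu>) f g) z"
    unfolding rankin_cohen_eis4_eis6[OF z]
    by (simp add: jac_def dd_potential Delta_def ddx_modular_form fg abcd)
  finally show ?thesis ..
qed

lemma admissible_jac: "admissible (jac (potential \<mu>))"
proof -
  have "jac (potential \<mu>) f g \<in> modular_forms"
    if "f \<in> modular_weight k" "g \<in> modular_weight l" for f g k l
    using homogeneous_jac_potential[of k 0 f l 0 g \<mu>] that modular_weight_iff
    by (auto simp: modular_weight_def)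
  moreover have "jac (potential \<mu>) f g \<in> quasimodular (k + l + 2) (s + t)"
    if "f \<in> quasimodular k s" "g \<in> quasimodular l t" for f g k l s t
    using homogeneous_jac_potential[of k "int s" f l "int t" g \<mu>] that
    by (simp add: quasimodular_iff)
  ultimately show ?thesis
    unfolding admissible_def using qm_fun_jac_eq_RC1 by blast
qed

section \<open>The Poisson center\<close>

text \<open>Upper bounds replace exact degrees because differentiation may kill a leading
  coefficient.\<close>

lemma coeff_mult_top:
  assumes "degree p \<le> m" "degree q \<le> n"
  shows "coeff (p * q) (m + n) = coeff p m * coeff q n"
proof -
  have "coeff (p * q) (m + n) = (\<Sum>i\<le>m + n. coeff p i * coeff q (m + n - i))"
    by (rule coeff_mult)
  also have "\<dots> = (\<Sum>i\<in>{m}. coeff p i * coeff q (m + n - i))"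
  proof (rule sum.mono_neutral_right)
    show "\<forall>i\<in>{..m + n} - {m}. coeff p i * coeff q (m + n - i) = 0"
    proof
      fix i assume "i \<in> {..m + n} - {m}"
      then have "i > m \<or> m + n - i > n" by auto
      then have "coeff p i = 0 \<or> coeff q (m + n - i) = 0"
        using assms by (meson coeff_eq_0 le_less_trans)
      then show "coeff p i * coeff q (m + n - i) = 0" by auto
    qed
  qed auto
  finally show ?thesis by simp
qed

interpretation dz: derivation "map_poly pderiv :: complex poly poly \<Rightarrow> complex poly poly"
  by (rule derivation.derivation_map_poly derivation_pderiv)+

interpretation dy: derivation "pderiv :: complex poly poly \<Rightarrow> complex poly poly"
  by (rule derivation_pderiv)

text \<open>
  The equations say that \<open>P / A\<^sup>n\<close> is constant; to stay within polynomials, the leading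
  coefficients in \<open>y\<close> are compared.
\<close>

lemma log_derivative_degree:
  fixes A P :: "complex poly poly"
  assumes A: "lead_coeff A = [:a:]" "a \<noteq> 0" "degree A > 0" and P: "P \<noteq> 0"
    and y: "A * pderiv P = of_nat n * (pderiv A * P)"
    and z: "A * map_poly pderiv P = of_nat n * (map_poly pderiv A * P)"
  shows "degree P = n * degree A" and "\<exists>c. lead_coeff P = [:c:]"
proof -
  define d m where "d = degree A" and "m = degree P"
  have d: "coeff A d = [:a:]" "d > 0" using A by (simp_all add: d_def)
  have lP: "coeff P m \<noteq> 0" using P by (simp add: m_def)
  show "degree P = n * degree A"
  proof -
    have dP: "degree (pderiv P) \<le> m - 1" and dA: "degree (pderiv A) \<le> d - 1"
      by (simp_all add: m_def d_def degree_pderiv)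
    \<comment> \<open>In the first equation the coefficients of \<open>y^(d + m - 1)\<close> yield
      \<open>m = n d\<close>. If \<open>m = 0\<close>, the index is truncated but both sides here
      are 0.\<close>
    have "of_nat m * (coeff A d * coeff P m) = coeff (A * pderiv P) (d + (m - 1))"
    proof (cases "m = 0")
      case True
      then have "pderiv P = 0" by (simp add: m_def pderiv_eq_0_iff)
      with True show ?thesis by simp
    next
      case False
      then show ?thesis
        using coeff_mult_top[OF order.refl dP, of A] by (simp add: d_def coeff_pderiv)
    qed
    also have "coeff (A * pderiv P) (d + (m - 1)) = of_nat n * coeff (pderiv A * P) (d + (m - 1))"
      unfolding y by (rule coeff_of_nat_mult)
    also have "coeff (pderiv A * P) (d + (m - 1)) = of_nat d * (coeff A d * coeff P m)" if "m > 0"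
      using coeff_mult_top[OF dA order.refl, of P] d that by (simp add: m_def coeff_pderiv)
    finally have eq: "m > 0 \<Longrightarrow> of_nat m * (coeff A d * coeff P m) = of_nat (n * d) * (coeff A d * coeff P m)"
      by (simp add: algebra_simps)
    have "coeff A d * coeff P m \<noteq> 0" using d lP A by simp
    with eq have "m = n * d" if "m > 0"
      using that by (metis mult_right_cancel of_nat_eq_iff)
    moreover have "n * d = 0" if "m = 0"
    proof -
      have "pderiv P = 0" using that by (simp add: m_def pderiv_eq_0_iff)
      then have "of_nat n * (pderiv A * P) = 0" using y by simp
      moreover have "pderiv A \<noteq> 0" using d by (simp add: d_def pderiv_eq_0_iff)
      ultimately show ?thesis using P by simp
    qed
    ultimately have "m = n * d" by (cases "m = 0") simp_all
    then show ?thesis by (simp only: m_def d_def)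
  qed
  show "\<exists>c. lead_coeff P = [:c:]"
  proof -
    have deg: "degree (map_poly pderiv P) \<le> m" "degree (map_poly pderiv A) \<le> d"
      by (auto simp: m_def d_def coeff_map_poly coeff_eq_0 intro!: degree_le)
    \<comment> \<open>In the second equation the coefficient of \<open>y^(d + m)\<close> on the
      right vanishes, because the leading coefficient of \<open>A\<close> does not depend on
      \<open>z\<close>.\<close>
    have "coeff A d * pderiv (coeff P m) = coeff (A * map_poly pderiv P) (d + m)"
      using coeff_mult_top[OF _ deg(1), of A d] by (simp add: d_def coeff_map_poly)
    also have "\<dots> = of_nat n * coeff (map_poly pderiv A * P) (d + m)"
      unfolding z by (rule coeff_of_nat_mult)
    also have "coeff (map_poly pderiv A * P) (d + m) = 0"
      using coeff_mult_top[OF deg(2), of P m] d by (simp add: m_def coeff_map_poly pderiv_pCons)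
    finally have "pderiv (coeff P m) = 0" using d A by simp
    then have "degree (lead_coeff P) = 0" by (simp add: m_def pderiv_eq_0_iff)
    then show ?thesis by (metis degree_eq_zeroE)
  qed
qed

text \<open>Subtracting the multiple of \<open>A^n\<close> with the same leading coefficient gives
  another solution \<open>Q\<close>. Its coefficient at \<open>n * degree A\<close> is 0, yet a
  nonzero solution must have exactly that degree.\<close>

lemma log_derivative_unique:
  fixes A P :: "complex poly poly"
  assumes A: "lead_coeff A = [:a:]" "a \<noteq> 0" "degree A > 0"
    and y: "A * pderiv P = of_nat n * (pderiv A * P)"
    and z: "A * map_poly pderiv P = of_nat n * (map_poly pderiv A * P)"
  shows "\<exists>c. P = [:[:c:]:] * A ^ n"
proof (cases "P = 0")
  case False
  note * = log_derivative_degree[OF A]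
  obtain c where c: "lead_coeff P = [:c:]" using *(2)[OF False y z] by blast
  define Q where "Q = P - [:[:c / a ^ n:]:] * A ^ n"
  have pow: "A * (of_nat n * A ^ (n - 1) * D) = of_nat n * (D * A ^ n)" for D
    by (cases n) (simp_all add: algebra_simps)
  have c0: "pderiv [:[:b:]:] = 0" "map_poly pderiv [:[:b:]:] = 0" for b :: complex
    by (simp_all add: pderiv_pCons derivation.map_poly_pCons[OF derivation_pderiv])
  have "A * pderiv Q = A * pderiv P - [:[:c / a ^ n:]:] * (A * (of_nat n * A ^ (n - 1) * pderiv A))"
    unfolding Q_def dy.diff dy.mult dy.power c0 by (simp add: algebra_simps)
  then have Qy: "A * pderiv Q = of_nat n * (pderiv A * Q)"
    unfolding pow y by (simp add: Q_def algebra_simps)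
  have "A * map_poly pderiv Q =
      A * map_poly pderiv P - [:[:c / a ^ n:]:] * (A * (of_nat n * A ^ (n - 1) * map_poly pderiv A))"
    unfolding Q_def dz.diff dz.mult dz.power c0 by (simp add: algebra_simps)
  then have Qz: "A * map_poly pderiv Q = of_nat n * (map_poly pderiv A * Q)"
    unfolding pow z by (simp add: Q_def algebra_simps)
  have "A \<noteq> 0" using A(3) by auto
  then have "degree (A ^ n) = n * degree A" by (rule degree_power_eq)
  then have "coeff (A ^ n) (n * degree A) = [:a:] ^ n"
    using lead_coeff_power[of A n] A(1) by simp
  then have "coeff Q (n * degree A) = [:c:] - [:c / a ^ n:] * [:a:] ^ n"
    using c *(1)[OF False y z] by (simp add: Q_def)
  also have "[:a:] ^ n = [:a ^ n:]" by (induction n) (simp_all add: one_pCons)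
  finally have "coeff Q (n * degree A) = 0" using A by simp
  then have "Q = 0" using *(1)[OF _ Qy Qz] by (metis leading_coeff_0_iff)
  then show ?thesis unfolding Q_def by (metis eq_iff_diff_eq_0)
qed (auto intro: exI[of _ 0])

section \<open>Polynomials in a single element\<close>

lemma poly_at_0 [simp]: "poly_at h 0 = 0"
  by (simp add: poly_at_def)

lemma poly_at_pCons: "poly_at h (pCons c p) = cst c + h * poly_at h p"
  by (simp add: poly_at_def map_poly_pCons)

lemma poly_at_add: "poly_at h (p + q) = poly_at h p + poly_at h q"
proof -
  have "map_poly cst (p + q) = map_poly cst p + map_poly cst q"
    by (rule poly_eqI) (simp add: coeff_map_poly, simp add: cst_def)
  then show ?thesis by (simp add: poly_at_def)
qed

lemma poly_at_monom: "poly_at h (monom c n) = cst c * h ^ n"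
  by (simp add: poly_at_def map_poly_monom poly_monom)

text \<open>An element of positive degree in \<open>E2\<close> is transcendental: a nonzero multiple
  of \<open>h\<close> cannot be constant. The resulting injectivity makes the range of
  \<open>poly_at h\<close> a polynomial algebra.\<close>

lemma poly_at_eq_0:
  assumes "degree h > 0" "poly_at h p = 0"
  shows "p = 0"
  using assms(2)
proof (induction p)
  case (pCons c p)
  have "poly_at h p = 0"
  proof (rule ccontr)
    assume nz: "poly_at h p \<noteq> 0"
    have "h * poly_at h p = - cst c"
      using pCons.prems by (simp add: poly_at_pCons eq_neg_iff_add_eq_0 add.commute)
    then have "degree (h * poly_at h p) = 0" by (simp add: cst_def)
    moreover have "h \<noteq> 0" using assms(1) by auto
    ultimately show False using nz assms(1) by (simp add: degree_mult_eq)
  qed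
  then show ?case using pCons by (simp add: poly_at_pCons)
qed simp

lemma inj_poly_at:
  assumes "degree h > 0"
  shows "inj (poly_at h)"
proof (rule injI)
  fix p q assume "poly_at h p = poly_at h q"
  then have "poly_at h (p - q) = 0" using poly_at_add[of h "p - q" q] by simp
  then show "p = q" using poly_at_eq_0[OF assms] by fastforce
qed

lemma jac_self: "jac k f k = 0"
  by (simp add: jac_def algebra_simps)

lemma poly_at_in_poisson_center: "poly_at k p \<in> poisson_center (jac k)"
proof -
  have "jac k f (poly_at k p) = 0" for f
  proof (induction p)
    case (pCons c p)
    then show ?case
      by (simp add: poly_at_pCons derivation.add[OF derivation_jac] derivation.mult[OF derivation_jac]
          poisson_bracket_cst[OF poisson_bracket_jac] jac_self)
  qed (simp add: derivation.zero[OF derivation_jac])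
  then show ?thesis by (simp add: poisson_center_def)
qed

lemma potential_pCons:
  obtains A B a where "potential \<mu> = [:B, A:]" "lead_coeff A = [:a:]" "a \<noteq> 0" "degree A > 0"
proof
  \<comment> \<open>The coefficient lists of \<open>B = \<mu> y^2 z\<close> and
    \<open>A = - 2 (y^3 - z^2)\<close>; the latter has the constant leading coefficient -2 in
    \<open>y\<close>.\<close>
  show "potential \<mu> = [:[:0, 0, [:0, \<mu>:]:], [:[:0, 0, 2:], 0, 0, [:- 2:]:]:]"
    by (simp add: potential_def Delta_def E2_def E4_def E6_def cst_def power_numeral_reduce numeral_poly)
  show "lead_coeff [:[:0, 0, 2:], 0, 0, [:- 2:]:] = [:- 2 :: complex:]"
    by simp
qed simp_all

text \<open>
  The potential is \<open>A x + B\<close> with \<open>A, B \<in> \<complex>[y, z]\<close>. The top coefficient in \<open>x\<close> of a central element of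
  degree \<open>n\<close> in \<open>x\<close> must be a multiple of \<open>A\<^sup>n\<close>, so that subtracting a multiple of the \<open>n\<close>-th power of the
  potential lowers the degree.
\<close>

lemma poisson_center_lead_coeff:
  assumes g: "g \<in> poisson_center (jac k)" and deg: "degree g \<le> n"
    and k: "k = [:B, A:]" "lead_coeff A = [:a:]" "a \<noteq> 0" "degree A > 0"
  shows "\<exists>c. coeff g n = [:[:c:]:] * A ^ n"
proof (rule log_derivative_unique[OF k(2,3,4)])
  have g0: "jac k f g = 0" for f using g by (simp add: poisson_center_def)
  have x: "ddx k = [:A:]" "degree (ddx k) \<le> 0" using k(1) by (simp_all add: pderiv_pCons)
  have y: "ddy k = [:pderiv B, pderiv A:]" using k(1)
    by (simp add: ddy_pCons)
  have z: "ddz k = [:map_poly pderiv B, map_poly pderiv A:]" using k(1)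
    by (simp add: ddz_pCons)
  have dx: "coeff (ddx g) n = 0" "n > 0 \<Longrightarrow> coeff (ddx g) (n - 1) = of_nat n * coeff g n"
    using deg by (simp_all add: coeff_pderiv coeff_eq_0)
  have dx0: "ddx g = 0" if "n = 0" using that deg by (simp add: pderiv_eq_0_iff)
  \<comment> \<open>Vanishing brackets with \<open>E4\<close> and \<open>E6\<close> say that the
    gradients of \<open>g\<close> and \<open>k\<close> are parallel.\<close>
  have "ddx k * ddz g = ddz k * ddx g" "ddx k * ddy g = ddy k * ddx g"
    using g0[of E4] g0[of E6] by (simp_all add: jac_def)
  then have "coeff ([:A:] * ddz g) n = coeff ([:map_poly pderiv B, map_poly pderiv A:] * ddx g) n"
    "coeff ([:A:] * ddy g) n = coeff ([:pderiv B, pderiv A:] * ddx g) n"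
    by (simp_all add: x y z)
  \<comment> \<open>As \<open>ddx g\<close> has no term in \<open>x^n\<close>, only the linear part
    \<open>c\<close> contributes, meeting the coefficient of \<open>x^(n - 1)\<close>.\<close>
  moreover have "coeff ([:b, c:] * ddx g) n = of_nat n * (c * coeff g n)" for b c
    using dx dx0 by (cases "n = 0") (auto simp: coeff_pCons algebra_simps split: nat.splits)
  ultimately show "A * pderiv (coeff g n) = of_nat n * (pderiv A * coeff g n)"
    "A * map_poly pderiv (coeff g n) = of_nat n * (map_poly pderiv A * coeff g n)"
    by (simp_all add: ddy_def ddz_def coeff_map_poly)
qed

lemma poisson_center_subset:
  assumes k: "k = [:B, A:]" "lead_coeff A = [:a:]" "a \<noteq> 0" "degree A > 0"
  shows "g \<in> poisson_center (jac k) \<Longrightarrow> g \<in> range (poly_at k)"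
proof (induction "degree g" arbitrary: g rule: less_induct)
  case less
  define n where "n = degree g"
  obtain c where c: "coeff g n = [:[:c:]:] * A ^ n"
    using poisson_center_lead_coeff[OF less.prems _ k] n_def by auto
  define h where "h = g - cst c * k ^ n"
  have "A \<noteq> 0" using k by auto
  then have degk: "degree k = 1" "lead_coeff k = A" using k(1) by simp_all
  then have "degree (k ^ n) = n" "coeff (k ^ n) n = A ^ n"
    using lead_coeff_power[of k n] \<open>A \<noteq> 0\<close> k(1) by (simp_all add: degree_power_eq)
  then have "coeff h n = 0" "degree h \<le> n"
    using c degree_mult_le[of "cst c" "k ^ n"]
    by (auto simp: h_def cst_def n_def intro!: degree_diff_le)
  have "h \<in> poisson_center (jac k)"
    using less.prems poly_at_in_poisson_center[of k "monom c n"]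
    by (simp add: poisson_center_def h_def poly_at_monom derivation.diff[OF derivation_jac])
  \<comment> \<open>For \<open>n = 0\<close> the degree cannot drop, and the vanishing coefficient
    forces \<open>h = 0\<close>; this ends the induction.\<close>
  moreover have "h = 0 \<or> degree h < degree g"
    using \<open>coeff h n = 0\<close> \<open>degree h \<le> n\<close> unfolding n_def
    by (metis le_neq_implies_less leading_coeff_0_iff)
  ultimately have "h \<in> range (poly_at k)"
    using less.hyps by (metis poly_at_0 rangeI)
  then obtain p where "h = poly_at k p" by blast
  then have "g = poly_at k (p + monom c n)"
    by (simp add: poly_at_add poly_at_monom h_def diff_eq_eq)
  then show ?case by blast
qed

theorem propositionC:
  "\<exists>br :: complex \<Rightarrow> qm \<Rightarrow> qm \<Rightarrow> qm.
     (\<forall>\<mu>. poisson_bracket (br \<mu>) \<and> admissible (br \<mu>) \<and> bracket_values \<mu> (br \<mu>) \<and>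
          (\<forall>b. poisson_bracket b \<and> bracket_values \<mu> b \<longrightarrow> b = br \<mu>)) \<and>
     (\<forall>\<mu>. jacobian_with_potential (br \<mu>) (potential \<mu>)) \<and>
     (\<forall>\<mu> \<mu>'. \<mu> \<noteq> 0 \<longrightarrow> \<mu>' \<noteq> 0 \<longrightarrow> poisson_modular_isomorphic (br \<mu>) (br \<mu>')) \<and>
     (\<forall>\<mu>. poisson_center (br \<mu>) = range (poly_at (potential \<mu>)) \<and> inj (poly_at (potential \<mu>)))"
proof (intro exI[of _ "\<lambda>\<mu>. jac (potential \<mu>)"] conjI allI impI)
  fix \<mu> b
  assume b: "poisson_bracket b \<and> bracket_values \<mu> b"
  show "b = jac (potential \<mu>)"
    by (rule poisson_bracket_eqI)
      (use b bracket_values_jac[of \<mu>] poisson_bracket_jac in \<open>simp_all add: bracket_values_def\<close>)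
next
  fix \<mu>
  obtain A B a where k: "potential \<mu> = [:B, A:]" "lead_coeff A = [:a:]" "a \<noteq> 0" "degree A > 0"
    by (rule potential_pCons)
  show "poisson_center (jac (potential \<mu>)) = range (poly_at (potential \<mu>))"
    using poisson_center_subset[OF k] poly_at_in_poisson_center by blast
  show "inj (poly_at (potential \<mu>))"
    using k by (intro inj_poly_at) auto
qed (simp_all add: poisson_bracket_jac admissible_jac bracket_values_jac jacobian_with_potential_jac
    poisson_modular_isomorphic_jac)

end
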